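(* Let $X$ and $Y$ be metrizable spaces. Suppose that there is a linear continuous surjection $T: D_p(X)\to D_p(Y)$, where either $D(X)=C(X)$ and $D(Y)=C(Y)$, or $D(X)=C^*(X)$ and $D(Y)=C^*(Y)$. If $X$ is scattered, then $Y$ is scattered.
   Context: $C(X)$ is the linear space of all continuous real-valued functions on $X$, and $C^*(X)\subset C(X)$ is the subspace of bounded functions. $D_p(X)$ denotes $D(X)$ endowed with the topology of pointwise convergence. A space $X$ is scattered if every nonempty subset $A$ of $X$ has an isolated point in $A$ (i.e. a point isolated in the subspace topology of $A$). *)

theory Defs
  imports "HOL-Analysis.Analysis"
begin

text \<open>Continuous real-valued functions on \<open>X\<close> are represented by their extensional versions
  (value \<open>undefined\<close> outside \<open>topspace X\<close>), so that equality of representatives is equality of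
  functions on \<open>X\<close>. This agrees with the carrier of \<^const>\<open>product_topology\<close>.\<close>

definition cont_funs :: "'a topology \<Rightarrow> ('a \<Rightarrow> real) set"
  where "cont_funs X = {f \<in> extensional (topspace X). continuous_map X euclideanreal f}"

definition bdd_cont_funs :: "'a topology \<Rightarrow> ('a \<Rightarrow> real) set"
  where "bdd_cont_funs X = {f \<in> cont_funs X. bounded (f ` topspace X)}"

definition pointwise_top :: "'a topology \<Rightarrow> ('a \<Rightarrow> real) set \<Rightarrow> ('a \<Rightarrow> real) topology"
  where "pointwise_top X D = subtopology (powertop_real (topspace X)) D"

text \<open>Linearity for the pointwise operations on extensional functions; the operations have to be
  restricted to the carrier to stay within the extensional functions.\<close>

definition linear_map_on ::
    "'a topology \<Rightarrow> 'b topology \<Rightarrow> ('a \<Rightarrow> real) set \<Rightarrow> (('a \<Rightarrow> real) \<Rightarrow> ('b \<Rightarrow> real)) \<Rightarrow> bool"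
  where "linear_map_on X Y D T \<longleftrightarrow>
    (\<forall>f\<in>D. \<forall>g\<in>D. T (\<lambda>x\<in>topspace X. f x + g x) = (\<lambda>y\<in>topspace Y. T f y + T g y)) \<and>
    (\<forall>c. \<forall>f\<in>D. T (\<lambda>x\<in>topspace X. c * f x) = (\<lambda>y\<in>topspace Y. c * T f y))"

definition scattered_space :: "'a topology \<Rightarrow> bool"
  where "scattered_space X \<longleftrightarrow>
    (\<forall>A. A \<subseteq> topspace X \<and> A \<noteq> {} \<longrightarrow> (\<exists>x\<in>A. openin (subtopology X A) {x}))"

lemma topspace_pointwise_top_cont_funs [simp]:
  "topspace (pointwise_top X (cont_funs X)) = cont_funs X"
  by (auto simp: pointwise_top_def cont_funs_def PiE_def)

lemma topspace_pointwise_top_bdd_cont_funs [simp]: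
  "topspace (pointwise_top X (bdd_cont_funs X)) = bdd_cont_funs X"
  by (auto simp: pointwise_top_def bdd_cont_funs_def cont_funs_def PiE_def)

end

theory Submission
  imports Defs "HOL-Library.Diagonal_Subsequence"
begin

text \<open>For every \<open>y\<close> the functional \<open>f \<mapsto> T f y\<close> is a finitely supported signed measure \<open>w y\<close>
  on \<open>X\<close>. Suppose \<open>Y\<close> contains a crowded set. Passing to closures, \<open>Y\<close> has a countable crowded
  closed subspace \<open>Z\<close> whose supports lie in a countable closed \<open>K \<subseteq> X\<close>: a separable scattered
  metrizable space is countable, and by linear independence only finitely many \<open>y\<close> share a given
  support. The scattered space \<open>K\<close> is completely metrizable. A gliding hump argument shows that the
  measures \<open>w y\<close> are locally uniformly concentrated on finite unions of small balls of \<open>K\<close>. Since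
  \<open>Z\<close> is countable and crowded, hence not complete, this produces a sequence \<open>y n\<close> without cluster
  points in \<open>Z\<close> all of whose measures concentrate on compact subsets of \<open>K\<close>. For \<open>C(X)\<close> the supports
  then lie in one compact set, so \<open>T f (y n)\<close> cannot grow arbitrarily fast. For \<open>C\<^sup>*(X)\<close> the measures
  are norm bounded and tight, so a subsequence converges weakly, although \<open>T f (y n)\<close> can be
  prescribed to oscillate.\<close>

section \<open>Finitely supported functionals and extension of functions\<close>

text \<open>The obstacle is that continuity of the functions \<open>T f\<close> controls the
  measures only locally in \<open>y\<close>, and for each scale \<open>(1/2) ^ j\<close> on a
  neighbourhood of its own, while compactness in \<open>K\<close> needs all scales at once.
  Shrinking neighbourhoods collect one scale after the other along a sequence. Were this sequence to
  converge, nothing would be wrong; countability and crowdedness of \<open>Z\<close> allow it to be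
  steered away from every point. The two reductions thus have opposite purposes: \<open>Z\<close>
  has to be so poor that sequences can escape, \<open>K\<close> so rich that sets totally bounded at
  every scale are compact. An escaping sequence is closed and discrete, so continuous functions take
  arbitrary values on it, and surjectivity passes this freedom on to \<open>T f\<close>. The two
  function spaces differ in what a hump may detect. Unbounded humps can magnify any nonzero weight
  and so confine whole supports; bounded humps see only mass, and a small remainder outside each
  compact set has to be tolerated. The weight \<open>\<sigma>\<close> carries this difference
  through a common argument.\<close>

abbreviation supp :: "('a \<Rightarrow> real) \<Rightarrow> 'a set"
  where "supp w \<equiv> {x. w x \<noteq> 0}"

definition pairing :: "('a \<Rightarrow> real) \<Rightarrow> ('a \<Rightarrow> real) \<Rightarrow> real"
  where "pairing w f = (\<Sum>x\<in>supp w. w x * f x)"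

text \<open>Total variation on \<open>A\<close> of the measure with weights
  \<open>w\<close>.\<close>

definition mass :: "('a \<Rightarrow> real) \<Rightarrow> 'a set \<Rightarrow> real"
  where "mass w A = (\<Sum>x\<in>supp w \<inter> A. \<bar>w x\<bar>)"

lemma pairing_cong: "(\<And>x. w x \<noteq> 0 \<Longrightarrow> f x = g x) \<Longrightarrow> pairing w f = pairing w g"
  by (simp add: pairing_def)

lemma pairing_sum: "pairing w (\<lambda>x. \<Sum>j\<in>J. c j * u j x) = (\<Sum>j\<in>J. c j * pairing w (u j))"
  unfolding pairing_def sum_distrib_left
  by (subst sum.swap) (simp add: algebra_simps)

lemma pairing_diff: "pairing w (\<lambda>x. f x - g x) = pairing w f - pairing w g"
  by (simp add: pairing_def algebra_simps sum_subtractf)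

lemma mass_nonneg: "0 \<le> mass w A"
  by (simp add: mass_def sum_nonneg)

lemma mass_mono: "finite (supp w) \<Longrightarrow> supp w \<inter> A \<subseteq> B \<Longrightarrow> mass w A \<le> mass w B"
  unfolding mass_def by (rule sum_mono2) auto

lemma abs_pairing_le:
  assumes "finite (supp w)" "\<And>x. w x \<noteq> 0 \<Longrightarrow> x \<in> A \<Longrightarrow> \<bar>f x\<bar> \<le> a"
    "\<And>x. w x \<noteq> 0 \<Longrightarrow> x \<notin> A \<Longrightarrow> \<bar>f x\<bar> \<le> b"
  shows "\<bar>pairing w f\<bar> \<le> a * mass w A + b * mass w (- A)"
proof -
  have "\<bar>pairing w f\<bar> \<le> (\<Sum>x\<in>supp w. \<bar>w x * f x\<bar>)"
    unfolding pairing_def by (rule sum_abs)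
  also have "\<dots> = (\<Sum>x\<in>supp w \<inter> A. \<bar>w x * f x\<bar>) + (\<Sum>x\<in>supp w \<inter> - A. \<bar>w x * f x\<bar>)"
    by (subst sum.union_disjoint [symmetric]) (auto simp: assms intro!: sum.cong)
  also have "\<dots> \<le> (\<Sum>x\<in>supp w \<inter> A. a * \<bar>w x\<bar>) + (\<Sum>x\<in>supp w \<inter> - A. b * \<bar>w x\<bar>)"
    by (intro add_mono sum_mono) (auto simp: abs_mult mult.commute assms intro!: mult_right_mono)
  finally show ?thesis
    by (simp add: mass_def sum_distrib_left)
qed

lemma abs_pairing_le_mass:
  assumes "finite (supp w)" "\<And>x. w x \<noteq> 0 \<Longrightarrow> \<bar>f x\<bar> \<le> a"
  shows "\<bar>pairing w f\<bar> \<le> a * mass w UNIV"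
  using abs_pairing_le[of w UNIV f a 0] assms by auto

text \<open>A greedy choice of coefficients: a term is switched on only if the earlier ones do not already
  make the sum large. No smallness of the off-diagonal entries is needed.\<close>

function adaptive :: "(nat \<Rightarrow> nat \<Rightarrow> real) \<Rightarrow> nat \<Rightarrow> real" where
  "adaptive a i = (if \<bar>a i i\<bar> / 2 \<le> \<bar>\<Sum>j<i. adaptive a j * a i j\<bar> then 0 else 1)"
  by auto
termination by (relation "inv_image less_than snd") auto

declare adaptive.simps [simp del]

lemma adaptive_range: "adaptive a i \<in> {0, 1}"
  by (subst adaptive.simps) auto

text \<open>Either the earlier terms already suffice, or they amount to less than half of
  \<open>a i i\<close> and adding all of \<open>a i i\<close> leaves more than half. Only entries to
  the right of the diagonal are left to the applications: in \<open>gliding_hump\<close> they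
  vanish, in \<open>uniform_boundedness\<close> they form a small tail.\<close>

lemma adaptive_sum: "\<bar>a i i\<bar> / 2 \<le> \<bar>\<Sum>j<Suc i. adaptive a j * a i j\<bar>"
proof -
  let ?s = "\<Sum>j<i. adaptive a j * a i j"
  have "adaptive a i = (if \<bar>a i i\<bar> / 2 \<le> \<bar>?s\<bar> then 0 else 1)"
    by (rule adaptive.simps)
  moreover have "(\<Sum>j<Suc i. adaptive a j * a i j) = ?s + adaptive a i * a i i"
    by simp
  moreover have "\<bar>a i i\<bar> \<le> \<bar>?s + a i i\<bar> + \<bar>?s\<bar>"
    by linarith
  ultimately show ?thesis
    by (cases "\<bar>a i i\<bar> / 2 \<le> \<bar>?s\<bar>") auto
qed

section \<open>Prescribing values on closed discrete sets\<close>

lemma extension_from_discrete: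
  assumes "normal_space X" and S: "closedin X S" and C: "closedin X C" and disj: "S \<inter> C = {}"
    and disc: "\<And>x. x \<in> S \<Longrightarrow> openin (subtopology X S) {x}"
    and I: "is_interval I" "0 \<in> I" "h ` S \<subseteq> I"
  obtains u :: "'a \<Rightarrow> real" where "continuous_map X euclideanreal u" "u ` topspace X \<subseteq> I"
    "\<And>x. x \<in> S \<Longrightarrow> u x = h x" "\<And>x. x \<in> C \<Longrightarrow> u x = 0"
proof -
  define f where "f = (\<lambda>x. if x \<in> S then h x else 0)"
  let ?Z = "subtopology X (S \<union> C)"
  have SC: "S \<subseteq> topspace X" "C \<subseteq> topspace X"
    using S C closedin_subset by auto
  have dS: "subtopology X S = discrete_topology S"
    using disc SC unfolding discrete_topology_unique [symmetric] by (simp add: discrete_topology_unique eq_commute inf.absorb2)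
  have "continuous_map ?Z euclideanreal f"
  proof (rule pasting_lemma_closed[where I = "{True, False}" and T = "\<lambda>b. if b then S else C"
        and f = "\<lambda>b. if b then h else (\<lambda>x. 0)"])
    fix b :: bool
    have "S \<subseteq> S \<union> C" "C \<subseteq> S \<union> C" by auto
    then show "closedin ?Z (if b then S else C)"
      using S C by (simp add: closedin_subset_topspace)
    have "subtopology ?Z S = discrete_topology S"
      by (simp add: subtopology_subtopology Int_absorb1 dS)
    then show "continuous_map (subtopology ?Z (if b then S else C)) euclideanreal
        (if b then h else (\<lambda>x. 0))"
      by simp
  qed (use SC disj in \<open>auto simp: f_def split: if_splits\<close>)
  moreover have "f ` (S \<union> C) \<subseteq> I"
    using I by (auto simp: f_def)
  ultimately obtain u where "continuous_map X euclideanreal u" "u ` topspace X \<subseteq> I"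
    "\<And>x. x \<in> S \<union> C \<Longrightarrow> u x = f x"
    using Tietze_extension_realinterval[of X "S \<union> C" I f] assms(1) S C I by (metis closedin_Un empty_iff)
  then show thesis
    using disj by (intro that[of u]) (auto simp: f_def)
qed

lemma extension_from_finite:
  assumes X: "metrizable_space X" and S: "finite S" "S \<subseteq> topspace X"
    and C: "closedin X C" and disj: "S \<inter> C = {}"
    and I: "is_interval I" "0 \<in> I" "h ` S \<subseteq> I"
  obtains u :: "'a \<Rightarrow> real" where "continuous_map X euclideanreal u" "u ` topspace X \<subseteq> I"
    "\<And>x. x \<in> S \<Longrightarrow> u x = h x" "\<And>x. x \<in> C \<Longrightarrow> u x = 0"
proof (rule extension_from_discrete[of X S C I h, OF metrizable_imp_normal_space[OF X] _ C disj _ I])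
  show "closedin X S"
    using S X by (simp add: closedin_Hausdorff_finite metrizable_imp_Hausdorff_space)
  have "Hausdorff_space (subtopology X S)"
    using X by (simp add: Hausdorff_space_subtopology metrizable_imp_Hausdorff_space)
  then have "subtopology X S = discrete_topology S"
    using S by (metis finite_topspace_imp_discrete_topology inf.absorb2 topspace_subtopology)
  then show "openin (subtopology X S) {x}" if "x \<in> S" for x
    using that by simp
qed (use that in blast)

section \<open>Gliding humps and uniform boundedness\<close>

text \<open>The scale \<open>\<sigma>\<close> is constant when bounded functions are to be produced; letting it depend on \<open>k\<close>
  makes every nonzero mass outside \<open>K m\<close> count, which controls the full supports.\<close>

lemma gliding_hump:
  fixes X :: "'a topology"
  assumes X: "metrizable_space X"
    and clK: "\<And>m. closedin X (K m)" and incK: "\<And>m. K m \<subseteq> K (Suc m)"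
    and cov: "topspace X \<subseteq> (\<Union>m. X interior_of K m)"
    and fin: "\<And>k. finite (supp (w k))" and sub: "\<And>k. supp (w k) \<subseteq> topspace X"
    and F: "finite F" "F \<subseteq> topspace X"
    and big: "\<And>m :: nat. \<exists>k :: nat. 1 < \<sigma> k * mass (w k) (- K m)"
  obtains f where "continuous_map X euclideanreal f"
    "\<And>x. x \<in> topspace X \<Longrightarrow> f x = 0 \<or> (\<exists>k. \<bar>f x\<bar> \<le> \<bar>\<sigma> k\<bar>)"
    "\<And>x. x \<in> F \<Longrightarrow> f x = 0" "infinite {k. 1/2 \<le> \<bar>pairing (w k) f\<bar>}"
proof -
  have monoK: "K m \<subseteq> K n" if "m \<le> n" for m n
    using lift_Suc_mono_le[of K, OF incK that] .
  have intK: "x \<in> X interior_of K m \<Longrightarrow> x \<in> K m" for x m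
    using interior_of_subset[of X "K m"] by auto
  have absorb: "\<exists>m>n. G \<subseteq> X interior_of K m" if G: "finite G" "G \<subseteq> topspace X" for G n
    using G
  proof (induction G)
    case empty
    show ?case by (rule exI[of _ "Suc n"]) simp
  next
    case (insert x G)
    then obtain m where m: "m > n" "G \<subseteq> X interior_of K m" by blast
    obtain m' where "x \<in> X interior_of K m'" using cov insert.prems by blast
    then have "insert x G \<subseteq> X interior_of K (max m m')"
      using m interior_of_mono[OF monoK, of m "max m m'" X] interior_of_mono[OF monoK, of m' "max m m'" X]
      by (meson insert_subset max.cobounded1 max.cobounded2 subset_trans subsetD)
    then show ?case using m(1) by (intro exI[of _ "max m m'"]) simp
  qed
  \<comment> \<open>A state \<open>(m, k)\<close> records a functional \<open>w k\<close> still
    heavy outside \<open>K m\<close>. The next level is so large that its interior swallows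
    \<open>supp (w k)\<close>; later humps live outside that level and are invisible to
    \<open>w k\<close>.\<close>
  let ?P = "\<lambda>(i::nat) p. F \<subseteq> K (fst p) \<and> 1 < \<sigma> (snd p) * mass (w (snd p)) (- K (fst p))"
  let ?Q = "\<lambda>(i::nat) p q. fst p < fst q \<and> supp (w (snd p)) \<subseteq> X interior_of K (fst q)"
  have "\<exists>p. \<forall>i. ?P i (p i) \<and> ?Q i (p i) (p (Suc i))"
  proof (rule dependent_nat_choice[where P = "?P" and Q = "?Q"])
    obtain m where "F \<subseteq> X interior_of K m" using absorb[OF F, of 0] by blast
    then have "F \<subseteq> K m" using intK by blast
    moreover obtain k where "1 < \<sigma> k * mass (w k) (- K m)" using big by blast
    ultimately have "?P 0 (m, k)" by simp
    then show "\<exists>p. ?P 0 p" by (rule exI)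
  next
    fix p and i :: nat assume P: "?P i p"
    obtain m where m: "m > fst p" "supp (w (snd p)) \<subseteq> X interior_of K m"
      using absorb[OF fin[of "snd p"] sub[of "snd p"], of "fst p"] by blast
    moreover obtain k where "1 < \<sigma> k * mass (w k) (- K m)" using big by blast
    moreover have "F \<subseteq> K m" using P monoK[OF less_imp_le[OF m(1)]] by (auto simp del: split_paired_All)
    ultimately have "?P (Suc i) (m, k) \<and> ?Q i p (m, k)" by simp
    then show "\<exists>q. ?P (Suc i) q \<and> ?Q i p q" by (rule exI)
  qed
  then obtain p where p: "\<forall>i. ?P i (p i) \<and> ?Q i (p i) (p (Suc i))" by (rule exE)
  define m where "m = fst \<circ> p"
  define k where "k = snd \<circ> p"
  have Fm: "F \<subseteq> K (m i)" and bigm: "1 < \<sigma> (k i) * mass (w (k i)) (- K (m i))" for i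
    using spec[OF p, of i] by (simp_all add: m_def k_def)
  have m_less: "m i < m (Suc i)" and supp_int: "supp (w (k i)) \<subseteq> X interior_of K (m (Suc i))" for i
    using spec[OF p, of i] by (simp_all add: m_def k_def)
  have "strict_mono m" using m_less by (simp add: strict_mono_Suc_iff)
  then have m_mono: "i \<le> j \<Longrightarrow> m i \<le> m j" and m_ge: "i \<le> m i" for i j
    by (simp_all add: strict_mono_less_eq seq_suble)
  have suppK: "supp (w (k i)) \<subseteq> K (m j)" if "i < j" for i j
    using supp_int[of i] intK[of _ "m (Suc i)"] monoK[OF m_mono, of "Suc i" j] that
    by auto
  \<comment> \<open>These open shells are pairwise disjoint. The part of \<open>w (k i)\<close>
    outside \<open>K (m i)\<close> lies in the shell \<open>V i\<close>, where \<open>u i\<close>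
    picks up its signs.\<close>
  define V where "V = (\<lambda>i. X interior_of K (m (Suc i)) - K (m i))"
  have opV: "openin X (V i)" for i
    unfolding V_def by (intro openin_diff openin_interior_of clK)
  have "\<exists>u. continuous_map X euclideanreal u \<and> u ` topspace X \<subseteq> {-1..1} \<and>
      (\<forall>x\<in>supp (w (k i)) - K (m i). u x = sgn (w (k i) x)) \<and> (\<forall>x\<in>topspace X - V i. u x = 0)" for i
  proof -
    let ?S = "supp (w (k i)) - K (m i)"
    have S: "finite ?S" "?S \<subseteq> topspace X" using fin sub by auto
    obtain u where "continuous_map X euclideanreal u" "u ` topspace X \<subseteq> {-1..1}"
      "\<And>x. x \<in> ?S \<Longrightarrow> u x = sgn (w (k i) x)" "\<And>x. x \<in> topspace X - V i \<Longrightarrow> u x = 0"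
    proof (rule extension_from_finite[OF X S, of "topspace X - V i" "{-1..1}" "\<lambda>x. sgn (w (k i) x)"])
      show "closedin X (topspace X - V i)" using opV by blast
      show "?S \<inter> (topspace X - V i) = {}" using supp_int[of i] by (auto simp: V_def)
    qed (auto simp: sgn_if is_interval_cc)
    then show ?thesis by blast
  qed
  then obtain u where u: "\<And>i. continuous_map X euclideanreal (u i) \<and> u i ` topspace X \<subseteq> {-1..1} \<and>
      (\<forall>x\<in>supp (w (k i)) - K (m i). u i x = sgn (w (k i) x)) \<and> (\<forall>x\<in>topspace X - V i. u i x = 0)"
    by metis
  have cu: "continuous_map X euclideanreal (u i)"
    and us: "w (k i) x \<noteq> 0 \<Longrightarrow> x \<notin> K (m i) \<Longrightarrow> u i x = sgn (w (k i) x)"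
    and u0: "x \<in> topspace X \<Longrightarrow> x \<notin> V i \<Longrightarrow> u i x = 0" for i x
    using u[of i] by auto
  have u1: "\<bar>u i x\<bar> \<le> 1" if "x \<in> topspace X" for i x
  proof -
    have "u i x \<in> {-1..1}" using u[of i] that by blast
    then show ?thesis by auto
  qed
  have pu: "pairing (w (k i)) (u i) = mass (w (k i)) (- K (m i))" for i
  proof -
    have "pairing (w (k i)) (u i) = (\<Sum>x\<in>supp (w (k i)). if x \<in> - K (m i) then \<bar>w (k i) x\<bar> else 0)"
      unfolding pairing_def
    proof (rule sum.cong[OF refl])
      fix x assume x: "x \<in> supp (w (k i))"
      then have "x \<in> topspace X" using sub by auto
      with x us[of i x] u0[of x i] show "w (k i) x * u i x = (if x \<in> - K (m i) then \<bar>w (k i) x\<bar> else 0)"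
        by (auto simp: V_def abs_sgn)
    qed
    then show ?thesis
      by (simp add: mass_def sum.inter_restrict fin)
  qed
  define a where "a = (\<lambda>i j. \<sigma> (k j) * pairing (w (k i)) (u j))"
  define c where "c = adaptive a"
  have c01: "c i = 0 \<or> c i = 1" for i using adaptive_range[of a i] by (auto simp: c_def)
  have aii: "a i i > 1" for i using bigm by (simp add: a_def pu)
  define S where "S = (\<lambda>i x. \<Sum>j<i. (c j * \<sigma> (k j)) * u j x)"
  \<comment> \<open>On \<open>K (m i)\<close> all humps of index \<open>i\<close> or more vanish, so
    any level containing \<open>x\<close> gives the same value as the least one, and
    \<open>f\<close> is a finite sum near every point.\<close>
  define f where "f = (\<lambda>x. S (LEAST i. x \<in> K (m i)) x)"
  have ex: "\<exists>i. x \<in> X interior_of K (m i)" if "x \<in> topspace X" for x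
  proof -
    obtain i where "x \<in> X interior_of K i" using cov \<open>x \<in> topspace X\<close> by blast
    then show ?thesis using interior_of_mono[OF monoK[OF m_ge[of i]]] by blast
  qed
  have fS: "f x = S i x" if "x \<in> K (m i)" for x i
  proof -
    let ?l = "LEAST i. x \<in> K (m i)"
    have l: "x \<in> K (m ?l)" "?l \<le> i" using that by (auto intro: LeastI Least_le)
    have "x \<in> topspace X" using clK l(1) closedin_subset by blast
    have "u j x = 0" if "j \<ge> ?l" for j
      using u0[OF \<open>x \<in> topspace X\<close>, of j] monoK[OF m_mono[OF that]] l(1) by (auto simp: V_def)
    then show ?thesis
      unfolding f_def S_def using l(2) by (intro sum.mono_neutral_left) auto
  qed
  show thesis
  proof (rule that[of f])
    show "continuous_map X euclideanreal f"
    proof (rule pasting_lemma[where I = UNIV and T = "\<lambda>i. X interior_of K (m i)" and f = S])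
      show "continuous_map (subtopology X (X interior_of K (m i))) euclideanreal (S i)" for i
        unfolding S_def
        by (intro continuous_map_from_subtopology continuous_map_sum continuous_map_real_mult cu) auto
      show "S i x = S j x" if "x \<in> topspace X \<inter> X interior_of K (m i) \<inter> X interior_of K (m j)" for i j x
        using that fS[of x i] fS[of x j] intK by auto
      show "\<exists>j. j \<in> UNIV \<and> x \<in> X interior_of K (m j) \<and> f x = S j x" if "x \<in> topspace X" for x
        using ex[OF that] fS intK by blast
    qed auto
    show "f x = 0" if "x \<in> F" for x
      using fS[of x 0] Fm[of 0] that by (auto simp: S_def)
    show "f x = 0 \<or> (\<exists>k. \<bar>f x\<bar> \<le> \<bar>\<sigma> k\<bar>)" if x: "x \<in> topspace X" for x
    proof (cases "\<exists>j. x \<in> V j")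
      case True
      then obtain j where j: "x \<in> V j" by blast
      then have xK: "x \<in> K (m (Suc j))" using intK by (auto simp: V_def)
      have "u i x = 0" if "i < j" for i
        using u0[OF x, of i] j monoK[OF m_mono, of "Suc i" j] that intK[of _ "m (Suc i)"]
        by (auto simp: V_def)
      then have "f x = c j * \<sigma> (k j) * u j x"
        by (simp add: fS[OF xK] S_def)
      moreover have "\<bar>c j * \<sigma> (k j) * u j x\<bar> \<le> \<bar>\<sigma> (k j)\<bar> * 1"
        unfolding abs_mult using c01[of j] u1[OF x, of j] by (intro mult_mono) auto
      ultimately show ?thesis by auto
    next
      case False
      then have "S i x = 0" for i
        using u0[OF x] by (simp add: S_def)
      then show ?thesis
        using ex[OF x] fS intK by metis
    qed
    have large: "1/2 \<le> \<bar>pairing (w (k i)) f\<bar>" for i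
    proof -
      have "pairing (w (k i)) f = pairing (w (k i)) (S (Suc i))"
        using suppK[of i "Suc i"] fS by (intro pairing_cong) auto
      also have "\<dots> = (\<Sum>j<Suc i. c j * a i j)"
        unfolding S_def pairing_sum by (simp add: a_def mult.assoc)
      finally show ?thesis
        using adaptive_sum[of a i] aii[of i] by (simp add: c_def)
    qed
    \<comment> \<open>Infinitely many different functionals are hit: \<open>w (k i)\<close> has no
      mass outside \<open>K (m j)\<close>, but \<open>w (k j)\<close> does.\<close>
    have "k i \<noteq> k j" if "i < j" for i j
    proof
      assume "k i = k j"
      then have "supp (w (k j)) \<inter> - K (m j) = {}" using suppK[OF that] by auto
      then show False using bigm[of j] by (simp add: mass_def)
    qed
    then have "inj k" by (metis injI linorder_neqE_nat)
    then have "infinite (range k)" by (rule range_inj_infinite)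
    then show "infinite {k. 1/2 \<le> \<bar>pairing (w k) f\<bar>}"
      by (rule infinite_super[rotated]) (use large in auto)
  qed
qed

text \<open>Banach-Steinhaus on the bounded continuous functions, with adaptive coefficients in
  place of a category argument: if the norms were unbounded, a uniformly convergent series of sign
  functions would be sent to an unbounded sequence.\<close>

lemma uniform_boundedness:
  fixes X :: "'a topology" and w :: "nat \<Rightarrow> 'a \<Rightarrow> real"
  assumes X: "metrizable_space X"
    and fin: "\<And>n. finite (supp (w n))" and sub: "\<And>n. supp (w n) \<subseteq> topspace X"
    and bdd: "\<And>f. continuous_map X euclideanreal f \<Longrightarrow> bounded (f ` topspace X) \<Longrightarrow>
      bounded (range (\<lambda>n. pairing (w n) f))"
  obtains B where "\<And>n. mass (w n) UNIV \<le> B"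
proof (rule ccontr)
  assume "\<not> thesis"
  \<comment> \<open>The power of 4 compensates the coefficient of the term \<open>i\<close>. Of the
    remaining norm the first \<open>Suc i\<close> terms secure a half and the tail destroys at most
    a third; the factor 6 makes the surviving sixth at least \<open>i\<close>.\<close>
  then have "\<exists>n. mass (w n) UNIV > 6 * real i * 4 ^ i" for i
    using that by (meson not_le)
  then obtain n where n: "\<And>i. mass (w (n i)) UNIV > 6 * real i * 4 ^ i" by metis
  define N where "N = (\<lambda>i. mass (w (n i)) UNIV)"
  have "\<exists>u. continuous_map X euclideanreal u \<and> (\<forall>x\<in>topspace X. \<bar>u x\<bar> \<le> 1) \<and>
      (\<forall>x\<in>supp (w (n i)). u x = sgn (w (n i) x))" for i
  proof -
    obtain u where "continuous_map X euclideanreal u" "u ` topspace X \<subseteq> {-1..1}"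
      "\<And>x. x \<in> supp (w (n i)) \<Longrightarrow> u x = sgn (w (n i) x)"
      by (rule extension_from_finite[OF X fin[of "n i"] sub[of "n i"], of "{}" "{-1..1}" "\<lambda>x. sgn (w (n i) x)"])
        (auto simp: sgn_if is_interval_cc)
    then show ?thesis by (intro exI[of _ u]) (auto simp: image_subset_iff abs_le_iff)
  qed
  then obtain u where u: "\<And>i. continuous_map X euclideanreal (u i) \<and> (\<forall>x\<in>topspace X. \<bar>u i x\<bar> \<le> 1) \<and>
      (\<forall>x\<in>supp (w (n i)). u i x = sgn (w (n i) x))"
    by metis
  have pu: "pairing (w (n i)) (u i) = N i" for i
    using u[of i] by (auto simp: pairing_def mass_def N_def abs_sgn intro!: sum.cong)
  define a where "a = (\<lambda>i j. (1/4) ^ j * pairing (w (n i)) (u j))"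
  define c where "c = adaptive a"
  define t where "t = (\<lambda>j x. (c j * (1/4) ^ j) * u j x)"
  define S where "S = (\<lambda>i x. \<Sum>j<i. t j x)"
  define f where "f = (\<lambda>x. \<Sum>j. t j x)"
  have t_le: "norm (t j x) \<le> (1/4) ^ j" if "x \<in> topspace X" for j x
  proof -
    have "\<bar>c j\<bar> \<le> 1" "\<bar>u j x\<bar> \<le> 1"
      using adaptive_range[of a j] u[of j] that by (auto simp: c_def)
    then have "\<bar>c j\<bar> * (1/4) ^ j * \<bar>u j x\<bar> \<le> 1 * (1/4) ^ j * 1"
      by (intro mult_mono) auto
    then show ?thesis by (simp add: t_def abs_mult)
  qed
  have geo: "(\<lambda>j. (1/4::real) ^ (j + i)) sums ((1/4) ^ i * (4/3))" for i
    using sums_mult[OF geometric_sums[of "1/4::real"], of "(1/4) ^ i"] by (simp add: power_add mult.commute)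
  have tail: "\<bar>f x - S i x\<bar> \<le> (1/4) ^ i * (4/3)" if "x \<in> topspace X" for i x
  proof -
    have sm: "summable (\<lambda>j. t j x)"
      by (rule summable_comparison_test'[OF sums_summable[OF geo[of 0]]]) (use t_le[OF that] in auto)
    then have "f x - S i x = (\<Sum>j. t (j + i) x)"
      using suminf_split_initial_segment[OF sm, of i] by (simp add: f_def S_def)
    also have "norm \<dots> \<le> (\<Sum>j. (1/4) ^ (j + i))"
      by (rule norm_suminf_le[OF t_le[OF that] sums_summable[OF geo]])
    also have "\<dots> = (1/4) ^ i * (4/3)" using geo[of i] by (rule sums_unique[symmetric])
    finally show ?thesis by simp
  qed
  have "continuous_map X euclideanreal f"
  proof (rule Met_TC.continuous_map_uniform_limit_alt[where f = S and F = sequentially, simplified])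
    show "\<forall>\<^sub>F i in sequentially. continuous_map X euclideanreal (S i)"
      unfolding S_def t_def
      by (intro always_eventually allI continuous_map_sum continuous_map_real_mult conjunct1[OF u]) auto
    fix e :: real assume "0 < e"
    have "(\<lambda>i. (1/4::real) ^ i * (4/3)) \<longlonglongrightarrow> 0 * (4/3)"
      by (intro tendsto_intros LIMSEQ_realpow_zero) auto
    then have "\<forall>\<^sub>F i in sequentially. (1/4::real) ^ i * (4/3) < e"
      by (rule order_tendstoD(2)) (use \<open>0 < e\<close> in simp)
    then show "\<forall>\<^sub>F i in sequentially. \<forall>x\<in>topspace X. dist (S i x) (f x) < e"
    proof (rule eventually_mono)
      fix i assume "(1/4::real) ^ i * (4/3) < e"
      then show "\<forall>x\<in>topspace X. dist (S i x) (f x) < e"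
        using tail[of _ i] unfolding dist_real_def by (force simp: abs_minus_commute)
    qed
  qed
  moreover have "bounded (f ` topspace X)"
    unfolding bounded_iff using tail[of _ 0] by (intro exI[of _ "4/3"]) (simp add: S_def)
  ultimately obtain B where B: "\<And>i. \<bar>pairing (w (n i)) f\<bar> \<le> B"
    using bdd[of f] by (auto simp: bounded_iff)
  have "real i \<le> \<bar>pairing (w (n i)) f\<bar>" for i
  proof -
    have "pairing (w (n i)) (S (Suc i)) = (\<Sum>j<Suc i. c j * a i j)"
      unfolding S_def t_def pairing_sum by (simp add: a_def mult.assoc)
    then have "(1/4) ^ i * N i / 2 \<le> \<bar>pairing (w (n i)) (S (Suc i))\<bar>"
      using adaptive_sum[of a i] mass_nonneg[of "w (n i)" UNIV] by (simp add: c_def a_def pu N_def)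
    moreover have "\<bar>pairing (w (n i)) f - pairing (w (n i)) (S (Suc i))\<bar> \<le> (1/4) ^ Suc i * (4/3) * N i"
      unfolding pairing_diff[symmetric] N_def
    proof (rule abs_pairing_le_mass[OF fin])
      fix x assume "w (n i) x \<noteq> 0"
      then have "x \<in> topspace X" using sub by blast
      then show "\<bar>f x - S (Suc i) x\<bar> \<le> (1/4) ^ Suc i * (4/3)" by (rule tail)
    qed
    moreover have "6 * real i \<le> (1/4) ^ i * N i"
    proof -
      have "(1/4) ^ i * (6 * real i * 4 ^ i) \<le> (1/4) ^ i * N i"
        using n[of i] by (intro mult_left_mono) (auto simp: N_def)
      then show ?thesis by (simp add: power_one_over)
    qed
    ultimately show ?thesis by (simp add: abs_if split: if_splits)
  qed
  with B have "real i \<le> B" for i using order_trans by blast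
  then show False using reals_Archimedean2[of B] by (meson not_le)
qed

text \<open>Nested balls with empty intersection, which exist because the space is countable and
  crowded: the ball of stage \<open>Suc n\<close> is kept away from the point \<open>e n\<close> of
  an enumeration, so the centres cluster nowhere. Each ball is also so small that one
  \<open>m\<close> serves \<open>P\<close> at its own index, which makes a local property uniform
  along the sequence.\<close>

lemma (in Metric_space) divergent_sequence_in_countable_crowded:
  assumes ne: "M \<noteq> {}" and cnt: "countable M"
    and crowded: "\<And>q r. q \<in> M \<Longrightarrow> r > 0 \<Longrightarrow> \<exists>z\<in>M. z \<noteq> q \<and> d q z < r"
    and mono: "\<And>j m m' y. m \<le> m' \<Longrightarrow> P j m y \<Longrightarrow> P j m' y"
    and loc: "\<And>q j. q \<in> M \<Longrightarrow> \<exists>r>0. \<exists>m. \<forall>z\<in>M. d q z < r \<longrightarrow> P j m z"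
  obtains y :: "nat \<Rightarrow> 'a" and s :: "nat \<Rightarrow> nat"
  where "range y \<subseteq> M" "inj y" "\<And>q. q \<in> M \<Longrightarrow> \<exists>r>0. finite {n. d q (y n) < r}"
    "\<And>j n. P j (s j) (y n)"
proof -
  define e where "e = from_nat_into M"
  have eM: "e n \<in> M" for n using ne by (simp add: e_def from_nat_into)
  let ?A = "\<lambda>n p. fst p \<in> M \<and> snd p > 0 \<and> (\<exists>m. \<forall>z\<in>M. d (fst p) z < snd p \<longrightarrow> P n m z)"
  let ?B = "\<lambda>n p p'. mball (fst p') (snd p') \<subseteq> mball (fst p) (snd p) \<and> fst p \<notin> mball (fst p') (snd p')
      \<and> mball (e n) (snd p') \<inter> mball (fst p') (snd p') = {}"
  have "\<exists>p. \<forall>n. ?A n (p n) \<and> ?B n (p n) (p (Suc n))"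
  proof (rule dependent_nat_choice[where P = "?A" and Q = "?B"])
    obtain q where q: "q \<in> M" using ne by blast
    obtain r m where "r > 0" "\<forall>z\<in>M. d q z < r \<longrightarrow> P 0 m z" using loc[OF q] by blast
    with q have "?A 0 (q, r)" by auto
    then show "\<exists>p. ?A 0 p" by (rule exI)
  next
    fix p and n :: nat assume "?A n p"
    then have p: "fst p \<in> M" "snd p > 0" by auto
    obtain z where z: "z \<in> M" "z \<noteq> fst p" "d (fst p) z < snd p" using crowded[OF p] by blast
    have "\<exists>z. z \<in> M \<and> z \<noteq> fst p \<and> d (fst p) z < snd p \<and> z \<noteq> e n"
    proof (cases "z = e n")
      case True
      have "d (fst p) z > 0" using z p by simp
      then obtain z' where "z' \<in> M" "z' \<noteq> fst p" "d (fst p) z' < d (fst p) z"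
        using crowded[OF p(1)] by blast
      then show ?thesis using z True by (intro exI[of _ z']) auto
    qed (use z in blast)
    then obtain c where c: "c \<in> M" "c \<noteq> fst p" "d (fst p) c < snd p" "c \<noteq> e n" by blast
    obtain r m where r: "r > 0" "\<forall>z\<in>M. d c z < r \<longrightarrow> P (Suc n) m z" using loc[OF c(1)] by blast
    \<comment> \<open>The four bounds in turn: one \<open>m\<close> serves \<open>P (Suc n)\<close>;
      the new ball stays in the old one; it misses the old centre, whence \<open>inj y\<close>;
      equal balls around \<open>e n\<close> and \<open>c\<close> are disjoint.\<close>
    define r' where "r' = min (min r (snd p - d (fst p) c)) (min (d (fst p) c) (d (e n) c / 2))"
    have half: "r' \<le> d (e n) c / 2"
      unfolding r'_def by (meson min.cobounded2 order_trans)
    have r': "r' > 0" "r' \<le> r" "r' \<le> snd p - d (fst p) c" "r' \<le> d (fst p) c"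
      unfolding r'_def using c r p eM[of n] by (simp_all add: min_le_iff_disj)
    have "?A (Suc n) (c, r')" using c(1) r(2) r'(1,2) by (auto intro!: exI[of _ m])
    moreover have "?B n p (c, r')"
    proof (intro conjI)
      show "mball (fst (c, r')) (snd (c, r')) \<subseteq> mball (fst p) (snd p)"
        using r' p c triangle[of "fst p" c] by fastforce
      show "fst p \<notin> mball (fst (c, r')) (snd (c, r'))"
        using r' by (auto simp: commute)
      show "mball (e n) (snd (c, r')) \<inter> mball (fst (c, r')) (snd (c, r')) = {}"
        using half triangle[of "e n" _ c] c(1) eM by (fastforce simp: commute)
    qed
    ultimately have "?A (Suc n) (c, r') \<and> ?B n p (c, r')" by (rule conjI)
    then show "\<exists>p'. ?A (Suc n) p' \<and> ?B n p p'" by (rule exI)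
  qed
  then obtain p where p: "\<forall>n. ?A n (p n) \<and> ?B n (p n) (p (Suc n))" by (rule exE)
  define y where "y = (\<lambda>n. fst (p n))"
  define r where "r = (\<lambda>n. snd (p n))"
  have yM: "y n \<in> M" and r0: "r n > 0" and Pm: "\<exists>m. \<forall>z\<in>M. d (y n) z < r n \<longrightarrow> P n m z"
    and B1: "mball (y (Suc n)) (r (Suc n)) \<subseteq> mball (y n) (r n)"
    and B2: "y n \<notin> mball (y (Suc n)) (r (Suc n))"
    and B3: "mball (e n) (r (Suc n)) \<inter> mball (y (Suc n)) (r (Suc n)) = {}" for n
    using spec[OF p, of n] by (simp_all add: y_def r_def)
  have nest: "y n \<in> mball (y j) (r j)" if "j \<le> n" for j n
  proof -
    have "mball (y n) (r n) \<subseteq> mball (y j) (r j)"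
      using lift_Suc_antimono_le[of "\<lambda>n. mball (y n) (r n)", OF B1 that] .
    moreover have "y n \<in> mball (y n) (r n)" using yM r0 by simp
    ultimately show ?thesis by blast
  qed
  \<comment> \<open>From index \<open>j\<close> on the sequence stays in the ball on which one
    \<open>m0\<close> serves \<open>P j\<close>; the finitely many earlier terms are absorbed by a
    maximum.\<close>
  have "\<exists>m. \<forall>n. P j m (y n)" for j
  proof -
    obtain m0 where m0: "\<forall>z\<in>M. d (y j) z < r j \<longrightarrow> P j m0 z" using Pm by blast
    have "\<exists>m. P j m (y n)" for n
    proof -
      obtain r m where "r > 0" "\<forall>z\<in>M. d (y n) z < r \<longrightarrow> P j m z" using loc[OF yM] by blast
      then show ?thesis using yM[of n] by (intro exI[of _ m]) simp
    qed
    then obtain m where m: "\<And>n. P j (m n) (y n)" by metis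
    show ?thesis
    proof (intro exI allI)
      fix n
      show "P j (Max (insert m0 (m ` {..<j}))) (y n)"
      proof (cases "n < j")
        case True
        then show ?thesis by (intro mono[OF _ m]) auto
      next
        case False
        then have "P j m0 (y n)" using m0 nest[of j n] by auto
        then show ?thesis by (rule mono[rotated]) auto
      qed
    qed
  qed
  then obtain s where s: "\<And>j n. P j (s j) (y n)" by metis
  show thesis
  proof (rule that)
    show "range y \<subseteq> M" using yM by auto
    have "y i \<noteq> y j" if "i < j" for i j
      using nest[of "Suc i" j] B2[of i] that by auto
    then show "inj y" by (metis injI linorder_neqE_nat)
    show "\<exists>r>0. finite {n. d q (y n) < r}" if q: "q \<in> M" for q
    proof -
      obtain n where n: "e n = q" using from_nat_into_surj[OF cnt q] by (auto simp: e_def)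
      have "{k. d q (y k) < r (Suc n)} \<subseteq> {..n}"
      proof (intro subsetI)
        fix k assume "k \<in> {k. d q (y k) < r (Suc n)}"
        then have "y k \<in> mball (e n) (r (Suc n))" using q n yM by auto
        then have "\<not> Suc n \<le> k" using B3[of n] nest[of "Suc n" k] by auto
        then show "k \<in> {..n}" by auto
      qed
      then show ?thesis using r0 finite_subset by blast
    qed
  qed (fact s)
qed

section \<open>Countable scattered metrizable spaces\<close>

text \<open>Cantor-Bendixson argument: points of the closure with a neighbourhood of countable trace
  are covered by countably many countable traces of balls centred in \<open>D\<close>. The others
  are condensation points, and one isolated among them would have a neighbourhood of countable trace
  after all.\<close>

lemma (in Metric_space) countable_closure_of_if_scattered:
  assumes sc: "scattered_space mtopology" and D: "countable D" "D \<subseteq> M"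
  shows "countable (mtopology closure_of D)"
proof -
  define C where "C = mtopology closure_of D"
  define A where "A = {x \<in> C. \<forall>r>0. \<not> countable (C \<inter> mball x r)}"
  define \<B> where "\<B> = (\<lambda>(p, n). C \<inter> mball p (inverse (real (Suc n)))) ` (D \<times> UNIV)"
  have C: "C \<subseteq> M" by (metis C_def closure_of_subset_topspace topspace_mtopology)
  have "C - A \<subseteq> (\<Union>B\<in>{B \<in> \<B>. countable B}. B)"
  proof
    fix x assume x: "x \<in> C - A"
    then obtain r where r: "r > 0" "countable (C \<inter> mball x r)" by (auto simp: A_def)
    obtain n where n: "inverse (real (Suc n)) < r / 2"
      using reals_Archimedean[of "r / 2"] r by auto
    have "inverse (real (Suc n)) > 0" by simp
    then obtain p where p: "p \<in> D" "p \<in> mball x (inverse (real (Suc n)))"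
      using x unfolding C_def metric_closure_of by blast
    have "mball p (inverse (real (Suc n))) \<subseteq> mball x r"
    proof
      fix z assume "z \<in> mball p (inverse (real (Suc n)))"
      then show "z \<in> mball x r"
        using n p triangle[of x p z] by auto
    qed
    then have "countable (C \<inter> mball p (inverse (real (Suc n))))"
      using countable_subset[OF _ r(2)] by blast
    moreover have "x \<in> mball p (inverse (real (Suc n)))"
      using p by (auto simp: commute)
    moreover have "C \<inter> mball p (inverse (real (Suc n))) \<in> \<B>"
      using p(1) by (auto simp: \<B>_def)
    ultimately show "x \<in> (\<Union>B\<in>{B \<in> \<B>. countable B}. B)" using x by blast
  qed
  moreover have "countable \<B>" unfolding \<B>_def using D by auto
  then have "countable ((\<Union>B\<in>{B \<in> \<B>. countable B}. B))"
    by (intro countable_UN countable_subset[OF _ \<open>countable \<B>\<close>]) auto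
  ultimately have CA: "countable (C - A)" by (rule countable_subset)
  \<comment> \<open>the set of condensation points has no isolated point\<close>
  have "A = {}"
  proof (rule ccontr)
    assume "A \<noteq> {}"
    moreover have "A \<subseteq> topspace mtopology" using C by (auto simp: A_def)
    ultimately obtain x where x: "x \<in> A" "openin (subtopology mtopology A) {x}"
      using sc unfolding scattered_space_def by blast
    then obtain U where U: "openin mtopology U" "{x} = U \<inter> A"
      by (auto simp: openin_subtopology)
    then obtain r where r: "r > 0" "mball x r \<subseteq> U" by (auto simp: openin_mtopology)
    then have "C \<inter> mball x r \<subseteq> insert x (C - A)" using U by blast
    then have "countable (C \<inter> mball x r)" using CA by (meson countable_insert countable_subset)
    then show False using x r by (auto simp: A_def)
  qed
  then show ?thesis using CA by (simp add: C_def)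
qed

text \<open>Call an open \<open>V\<close> good if \<open>V - S\<close> is an \<open>F\<^sub>\<sigma>\<close>. As \<open>S\<close> is countable, some good \<open>W\<close> contains every
  point of \<open>S\<close> that lies in a good set; an isolated point of \<open>S - W\<close> could be added to \<open>W\<close>, so
  \<open>S \<subseteq> W\<close>.\<close>

lemma gdelta_in_if_countable_scattered:
  assumes E: "metrizable_space E" and S: "S \<subseteq> topspace E" "countable S"
    and sc: "scattered_space (subtopology E S)"
  shows "gdelta_in E S"
proof -
  let ?good = "\<lambda>V. openin E V \<and> fsigma_in E (V - S)"
  let ?S' = "{x \<in> S. \<exists>V. ?good V \<and> x \<in> V}"
  have "\<forall>x\<in>?S'. \<exists>V. ?good V \<and> x \<in> V" by blast
  from bchoice[OF this] obtain V where V: "\<forall>x\<in>?S'. ?good (V x) \<and> x \<in> V x" by (rule exE)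
  define W where "W = (\<Union>x\<in>?S'. V x)"
  have opW: "openin E W" unfolding W_def using V by (intro openin_Union) auto
  have "W - S = (\<Union>x\<in>?S'. V x - S)" by (auto simp: W_def)
  moreover have "fsigma_in E (\<Union>x\<in>?S'. V x - S)"
    using V S by (intro fsigma_in_Union) (auto intro!: countable_image)
  ultimately have fW: "fsigma_in E (W - S)" by simp
  have in_W: "x \<in> W" if "x \<in> S" "?good U" "x \<in> U" for x U
  proof -
    have "x \<in> ?S'" using that by blast
    then show ?thesis using V unfolding W_def by blast
  qed
  have "S \<subseteq> W"
  proof (rule ccontr)
    assume "\<not> S \<subseteq> W"
    then have "S - W \<subseteq> topspace (subtopology E S)" "S - W \<noteq> {}" using S by auto
    then obtain x where x: "x \<in> S - W" "openin (subtopology (subtopology E S) (S - W)) {x}"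
      using sc unfolding scattered_space_def by blast
    then have "openin (subtopology E (S - W)) {x}"
      by (simp add: subtopology_subtopology Int_absorb1)
    then obtain U where U: "openin E U" "{x} = U \<inter> (S - W)"
      by (auto simp: openin_subtopology)
    have "(W \<union> U) - S = (W - S) \<union> ((U - W) - {x})" using U(2) x by blast
    moreover have "fsigma_in E ((U - W) - {x})"
    proof (intro fsigma_in_diff)
      show "fsigma_in E U" using E U by (simp add: open_imp_fsigma_in)
      show "gdelta_in E W" using opW by (rule open_imp_gdelta_in)
      have "closedin E {x}" using E x S by (simp add: closedin_Hausdorff_singleton metrizable_imp_Hausdorff_space subset_iff)
      then show "gdelta_in E {x}" using E by (simp add: closed_imp_gdelta_in)
    qed
    ultimately have "?good (W \<union> U)" using fW opW U by (simp add: fsigma_in_Un openin_Un)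
    then have "x \<in> W" using in_W[of x "W \<union> U"] U x by blast
    then show False using x by blast
  qed
  then have "S = W - (W - S)" by blast
  then show ?thesis using gdelta_in_diff[OF open_imp_gdelta_in[OF opW] fW] by simp
qed

lemma scattered_space_homeomorphic_map:
  assumes f: "homeomorphic_map X Y f" and sc: "scattered_space X"
  shows "scattered_space Y"
  unfolding scattered_space_def
proof (intro allI impI)
  fix A assume A: "A \<subseteq> topspace Y \<and> A \<noteq> {}"
  define B where "B = {x \<in> topspace X. f x \<in> A}"
  have fim: "f ` topspace X = topspace Y" by (rule homeomorphic_imp_surjective_map[OF f])
  have BA: "f ` B = A"
  proof
    show "f ` B \<subseteq> A" by (auto simp: B_def)
    show "A \<subseteq> f ` B"
    proof
      fix y assume "y \<in> A"
      then have "y \<in> f ` topspace X" using A fim by blast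
      then show "y \<in> f ` B" using \<open>y \<in> A\<close> by (auto simp: B_def)
    qed
  qed
  have B: "B \<subseteq> topspace X" "B \<noteq> {}" using A BA by (auto simp: B_def)
  from sc have "B \<subseteq> topspace X \<and> B \<noteq> {} \<longrightarrow> (\<exists>x\<in>B. openin (subtopology X B) {x})"
    unfolding scattered_space_def by (rule spec)
  then obtain x where x: "x \<in> B" "openin (subtopology X B) {x}"
    using B by blast
  have hom: "homeomorphic_map (subtopology X B) (subtopology Y A) f"
    by (rule homeomorphic_map_subtopologies[OF f]) (use BA A B in \<open>simp add: inf.absorb2\<close>)
  have "openin (subtopology Y A) (f ` {x})"
    using x homeomorphic_map_openness_eq[OF hom, of "{x}"] by blast
  then show "\<exists>y\<in>A. openin (subtopology Y A) {y}" using x(1) BA by auto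
qed

text \<open>The image in a completion is again countable and scattered, hence a G-delta set there,
  and G-delta subsets inherit complete metrizability.\<close>

lemma completely_metrizable_if_countable_scattered:
  assumes X: "metrizable_space X" and cnt: "countable (topspace X)" and sc: "scattered_space X"
  shows "completely_metrizable_space X"
proof -
  obtain f :: "['a,'a] \<Rightarrow> real" and E where E: "completely_metrizable_space E"
    and emb: "embedding_map X E f"
    by (rule metrizable_space_completion[OF X])
  let ?S = "f ` topspace X"
  have hom: "homeomorphic_map X (subtopology E ?S) f"
    using emb by (simp add: embedding_map_def)
  have "?S = topspace E \<inter> ?S"
    using homeomorphic_imp_surjective_map[OF hom] unfolding topspace_subtopology .
  then have "?S \<subseteq> topspace E" by blast
  moreover have "scattered_space (subtopology E ?S)"
    by (rule scattered_space_homeomorphic_map[OF hom sc])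
  ultimately have "gdelta_in E ?S"
    using cnt E
    by (intro gdelta_in_if_countable_scattered) (simp_all add: completely_metrizable_imp_metrizable_space)
  then have "completely_metrizable_space (subtopology E ?S)"
    by (rule completely_metrizable_space_gdelta_in[OF E])
  then show ?thesis
    using homeomorphic_completely_metrizable_space[OF homeomorphic_map_imp_homeomorphic_space[OF hom]] by simp
qed

section \<open>Compactness and separability\<close>

text \<open>Gaussian elimination with pivot \<open>i0\<close>: the rows
  \<open>a i - q i * a i0\<close> vanish at \<open>x\<close>, and the coefficient of the pivot row
  is recovered at the end. It limits how many \<open>w y\<close> with the same support can be
  linearly independent.\<close>

lemma nontrivial_linear_relation:
  fixes a :: "'i \<Rightarrow> 'x \<Rightarrow> real"
  assumes "finite F" "finite I" "card F < card I"
  shows "\<exists>c. (\<exists>i\<in>I. c i \<noteq> 0) \<and> (\<forall>x\<in>F. (\<Sum>i\<in>I. c i * a i x) = 0)"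
  using assms
proof (induction F arbitrary: I a)
  case empty
  then have "I \<noteq> {}" by auto
  then show ?case by (intro exI[of _ "\<lambda>_. 1"]) auto
next
  case (insert x F)
  show ?case
  proof (cases "\<forall>i\<in>I. a i x = 0")
    case True
    have "card F < card I" using insert.prems insert.hyps by simp
    then obtain c where c: "\<exists>i\<in>I. c i \<noteq> 0" "\<forall>y\<in>F. (\<Sum>i\<in>I. c i * a i y) = 0"
      using insert.IH[of I a] insert.prems by blast
    have "(\<Sum>i\<in>I. c i * a i x) = 0" using True by (intro sum.neutral) simp
    then show ?thesis using c by (intro exI[of _ c]) simp
  next
    case False
    then obtain i0 where i0: "i0 \<in> I" "a i0 x \<noteq> 0" by blast
    define q where "q = (\<lambda>i. a i x / a i0 x)"
    have "card F < card (I - {i0})" using insert.prems insert.hyps i0 by simp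
    then obtain c where c: "\<exists>i\<in>I - {i0}. c i \<noteq> 0"
      "\<forall>y\<in>F. (\<Sum>i\<in>I - {i0}. c i * (a i y - q i * a i0 y)) = 0"
      using insert.IH[of "I - {i0}" "\<lambda>i y. a i y - q i * a i0 y"] insert.prems by auto
    define s where "s = (\<Sum>i\<in>I - {i0}. c i * q i)"
    define c' where "c' = c(i0 := - s)"
    have eq: "(\<Sum>i\<in>I. c' i * a i y) = (\<Sum>i\<in>I - {i0}. c i * (a i y - q i * a i0 y))" for y
    proof -
      have "(\<Sum>i\<in>I. c' i * a i y) = c' i0 * a i0 y + (\<Sum>i\<in>I - {i0}. c' i * a i y)"
        using i0(1) insert.prems(1) by (rule sum.remove[rotated])
      also have "(\<Sum>i\<in>I - {i0}. c' i * a i y) = (\<Sum>i\<in>I - {i0}. c i * a i y)"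
        by (intro sum.cong) (auto simp: c'_def)
      also have "c' i0 = - s" by (simp add: c'_def)
      also have "- s * a i0 y + (\<Sum>i\<in>I - {i0}. c i * a i y) = (\<Sum>i\<in>I - {i0}. c i * (a i y - q i * a i0 y))"
        by (simp add: s_def sum_distrib_left sum_subtractf algebra_simps)
      finally show ?thesis .
    qed
    have "(\<Sum>i\<in>I. c' i * a i x) = 0" unfolding eq using i0 by (simp add: q_def)
    then have "\<forall>y\<in>insert x F. (\<Sum>i\<in>I. c' i * a i y) = 0" using c(2) eq by simp
    moreover have "\<exists>i\<in>I. c' i \<noteq> 0" using c(1) by (auto simp: c'_def)
    ultimately show ?thesis by blast
  qed
qed

lemma diagonal_convergent_subsequence:
  fixes a :: "nat \<Rightarrow> nat \<Rightarrow> real"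
  assumes bdd: "\<And>k. bounded (range (a k))"
  obtains r where "strict_mono r" "\<And>k. convergent (\<lambda>n. a k (r n))"
proof -
  interpret subseqs "\<lambda>k s. convergent (a k \<circ> s)"
  proof
    fix k and s :: "nat \<Rightarrow> nat"
    have "bounded (range (a k \<circ> s))"
      by (rule bounded_subset[OF bdd[of k]]) auto
    then obtain l r where "strict_mono r" "(a k \<circ> s \<circ> r) \<longlonglongrightarrow> l"
      using bounded_imp_convergent_subsequence by blast
    then show "\<exists>r. strict_mono r \<and> convergent (a k \<circ> (s \<circ> r))"
      by (auto simp: convergent_def o_assoc)
  qed
  show thesis
  proof (rule that[OF subseq_diagseq])
    fix k
    have "convergent (a k \<circ> (diagseq \<circ> (+) (Suc k)))"
    proof (rule diagseq_holds)
      fix r s n assume "strict_mono (r :: nat \<Rightarrow> nat)" "convergent (a n \<circ> s)"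
      then show "convergent (a n \<circ> (s \<circ> r))"
        unfolding o_assoc convergent_def by (blast intro: LIMSEQ_subseq_LIMSEQ)
    qed
    then have "convergent (\<lambda>n. a k (diagseq (n + Suc k)))"
      by (simp add: o_def add.commute)
    then show "convergent (\<lambda>n. a k (diagseq n))"
      by (rule iffD1[OF convergent_ignore_initial_segment[of "\<lambda>n. a k (diagseq n)" "Suc k"]])
  qed
qed

section \<open>Metric criteria for continuity and compactness\<close>

context Metric_space begin

lemma continuous_map_real_iff:
  "continuous_map mtopology euclideanreal f \<longleftrightarrow>
    (\<forall>a\<in>M. \<forall>\<epsilon>>0. \<exists>\<delta>>0. \<forall>x. x \<in> M \<and> d a x < \<delta> \<longrightarrow> \<bar>f a - f x\<bar> < \<epsilon>)"
  using metric_continuous_map[OF Met_TC.Metric_space_axioms, of f]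
  by (simp add: dist_real_def)

lemma continuous_map_mdist_left: "p \<in> M \<Longrightarrow> continuous_map mtopology euclideanreal (d p)"
  unfolding continuous_map_real_iff
proof (intro ballI allI impI)
  fix a \<epsilon> assume "p \<in> M" "a \<in> M" "(0::real) < \<epsilon>"
  have "\<bar>d p a - d p x\<bar> \<le> d a x" if "x \<in> M" for x
    using triangle[of p a x] triangle[of p x a] commute[of x a] that \<open>p \<in> M\<close> \<open>a \<in> M\<close> by auto
  then show "\<exists>\<delta>>0. \<forall>x. x \<in> M \<and> d a x < \<delta> \<longrightarrow> \<bar>d p a - d p x\<bar> < \<epsilon>"
    using \<open>0 < \<epsilon>\<close> by (meson le_less_trans)
qed

text \<open>The centres may lie outside \<open>L\<close>, whereas total boundedness wants them
  inside. Moving each to a point of its ball in \<open>L\<close> doubles the radius, and thirds of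
  \<open>\<epsilon>\<close> keep the inequality strict.\<close>

lemma compactin_if_finite_covers:
  assumes "mcomplete" and L: "closedin mtopology L"
    and cov: "\<And>\<epsilon>. \<epsilon> > 0 \<Longrightarrow> \<exists>C. finite C \<and> L \<subseteq> (\<Union>c\<in>C. mcball c \<epsilon>)"
  shows "compactin mtopology L"
proof -
  have "mtotally_bounded L"
    unfolding mtotally_bounded_def
  proof (intro allI impI)
    fix \<epsilon> :: real assume "\<epsilon> > 0"
    then obtain C where C: "finite C" "L \<subseteq> (\<Union>c\<in>C. mcball c (\<epsilon> / 3))"
      using cov[of "\<epsilon> / 3"] by auto
    define z where "z = (\<lambda>c. SOME z. z \<in> L \<inter> mcball c (\<epsilon> / 3))"
    let ?K = "z ` {c \<in> C. L \<inter> mcball c (\<epsilon> / 3) \<noteq> {}}"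
    have z: "z c \<in> L \<inter> mcball c (\<epsilon> / 3)" if "x \<in> L \<inter> mcball c (\<epsilon> / 3)" for x c
      unfolding z_def using that by (rule someI)
    have "L \<subseteq> (\<Union>x\<in>?K. mball x \<epsilon>)"
    proof
      fix x assume x: "x \<in> L"
      then obtain c where c: "c \<in> C" "x \<in> mcball c (\<epsilon> / 3)" using C by blast
      then have zc: "z c \<in> L \<inter> mcball c (\<epsilon> / 3)" using z x by blast
      have "x \<in> mball (z c) \<epsilon>"
        using c zc triangle[of "z c" c x] \<open>\<epsilon> > 0\<close> by (auto simp: commute)
      then show "x \<in> (\<Union>x\<in>?K. mball x \<epsilon>)" using x c by blast
    qed
    moreover have "finite ?K" "?K \<subseteq> L" using C z by auto
    ultimately show "\<exists>K. finite K \<and> K \<subseteq> L \<and> L \<subseteq> (\<Union>x\<in>K. mball x \<epsilon>)" by blast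
  qed
  then show ?thesis
    using mtotally_bounded_eq_compact_closure_of[OF \<open>mcomplete\<close>] closure_of_closedin[OF L] by metis
qed

end

section \<open>Truncated minima of distance cones, after McShane's extension formula\<close>

primrec min_cone :: "('a \<Rightarrow> 'a \<Rightarrow> real) \<Rightarrow> real \<Rightarrow> real \<Rightarrow> (real \<times> 'a) list \<Rightarrow> 'a \<Rightarrow> real" where
  "min_cone d k c [] x = c"
| "min_cone d k c (p # ps) x = min (fst p + k * d (snd p) x) (min_cone d k c ps x)"

lemma min_cone_le: "min_cone d k c ps x \<le> c"
  by (induction ps) auto

lemma min_cone_le_cone: "(a, p) \<in> set ps \<Longrightarrow> min_cone d k c ps x \<le> a + k * d p x"
  by (induction ps) auto

lemma le_min_cone: "v \<le> c \<Longrightarrow> (\<And>a p. (a, p) \<in> set ps \<Longrightarrow> v \<le> a + k * d p x) \<Longrightarrow> v \<le> min_cone d k c ps x"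
  by (induction ps) auto

text \<open>Natural slopes and truncation levels and rational apex values keep the family countable
  for countable \<open>M\<close>. It replaces a uniformly dense countable set, which the bounded
  continuous functions on a noncompact metrizable space do not have: approximation is wanted only on
  compact sets, under a common bound.\<close>

definition test_functions :: "('a \<Rightarrow> 'a \<Rightarrow> real) \<Rightarrow> 'a set \<Rightarrow> ('a \<Rightarrow> real) set" where
  "test_functions d M = (\<lambda>(c, k, ps) x. max (- real c) (min_cone d (real k) (real c) ps x)) `
    (UNIV \<times> UNIV \<times> lists (\<rat> \<times> M))"

lemma countable_test_functions: "countable M \<Longrightarrow> countable (test_functions d M)"
  unfolding test_functions_def by (intro countable_image countable_SIGMA countable_lists countable_rat) auto

context Metric_space begin

lemma continuous_map_min_cone:
  "ps \<in> lists (UNIV \<times> M) \<Longrightarrow> continuous_map mtopology euclideanreal (min_cone d k c ps)"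
proof (induction ps)
  case Nil
  then show ?case by simp
next
  case (Cons p ps)
  have "continuous_map mtopology euclideanreal (\<lambda>x. min (fst p + k * d (snd p) x) (min_cone d k c ps x))"
    using Cons by (intro continuous_map_real_min continuous_map_add continuous_map_real_mult continuous_map_mdist_left) auto
  then show ?case by simp
qed

lemma test_functions_continuous_bounded:
  assumes "h \<in> test_functions d M"
  shows "continuous_map mtopology euclideanreal h" "bounded (h ` M)"
proof -
  obtain c k ps where ps: "ps \<in> lists (\<rat> \<times> M)"
    and h: "h = (\<lambda>x. max (- real c) (min_cone d (real k) (real c) ps x))"
    using assms by (auto simp: test_functions_def)
  have "ps \<in> lists (UNIV \<times> M)" using ps by auto
  then show "continuous_map mtopology euclideanreal h"
    unfolding h by (intro continuous_map_real_max continuous_map_min_cone) auto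
  have "\<bar>h x\<bar> \<le> real c" for x
    using min_cone_le[of d "real k" "real c" ps x] unfolding h by auto
  then show "bounded (h ` M)" unfolding bounded_iff by auto
qed

lemma uniformly_continuous_near_compact:
  assumes L: "compactin mtopology L" and f: "continuous_map mtopology euclideanreal f" and "\<epsilon> > 0"
  obtains \<eta> where "\<eta> > 0" "\<And>x y. x \<in> L \<Longrightarrow> y \<in> M \<Longrightarrow> d x y < \<eta> \<Longrightarrow> \<bar>f x - f y\<bar> < \<epsilon>"
proof -
  define U where "U = (\<lambda>a. {x \<in> topspace mtopology. f x \<in> ball (f a) (\<epsilon> / 2)})"
  have LM: "L \<subseteq> M" using L compactin_subset_topspace by fastforce
  have "L \<subseteq> \<Union>(U ` M)" using LM \<open>\<epsilon> > 0\<close> by (auto simp: U_def)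
  moreover have "openin mtopology (U a)" for a
    unfolding U_def by (rule openin_continuous_map_preimage[OF f]) simp
  then have "openin mtopology V" if "V \<in> U ` M" for V
    using that by auto
  ultimately obtain \<eta> where \<eta>: "\<eta> > 0" "\<forall>x\<in>L. \<exists>V\<in>U ` M. mball x \<eta> \<subseteq> V"
    using lebesgue_number[OF L, of "U ` M"] by blast
  have "\<bar>f x - f y\<bar> < \<epsilon>" if xy: "x \<in> L" "y \<in> M" "d x y < \<eta>" for x y
  proof -
    obtain a where a: "mball x \<eta> \<subseteq> U a" using \<eta> xy by blast
    have "x \<in> mball x \<eta>" "y \<in> mball x \<eta>" using xy \<eta> LM by auto
    then have "x \<in> U a" "y \<in> U a" using a by auto
    then have "\<bar>f a - f x\<bar> < \<epsilon> / 2" "\<bar>f a - f y\<bar> < \<epsilon> / 2" by (simp_all add: U_def dist_real_def)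
    then show ?thesis by linarith
  qed
  then show thesis using that \<eta> by blast
qed

text \<open>Cones with apexes in a finite net of \<open>L\<close>, raised slightly above
  \<open>f\<close>, have a minimum close to \<open>f\<close> on \<open>L\<close>. Off
  \<open>L\<close> the only information on \<open>h\<close> is the bound \<open>c\<close> preserved
  by truncation.\<close>

lemma test_functions_approximate:
  assumes L: "compactin mtopology L" and f: "continuous_map mtopology euclideanreal f"
    and c: "\<And>x. x \<in> M \<Longrightarrow> \<bar>f x\<bar> \<le> real c" and "\<epsilon> > 0"
  obtains h where "h \<in> test_functions d M" "\<And>x. \<bar>h x\<bar> \<le> real c" "\<And>x. x \<in> L \<Longrightarrow> \<bar>f x - h x\<bar> \<le> \<epsilon>"
proof -
  have LM: "L \<subseteq> M" using L compactin_subset_topspace by fastforce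
  obtain \<eta> where \<eta>: "\<eta> > 0" "\<And>x y. x \<in> L \<Longrightarrow> y \<in> M \<Longrightarrow> d x y < \<eta> \<Longrightarrow> \<bar>f x - f y\<bar> < \<epsilon> / 3"
    using uniformly_continuous_near_compact[OF L f, of "\<epsilon> / 3"] \<open>\<epsilon> > 0\<close> by auto
  \<comment> \<open>Over a distance \<open>\<eta>\<close> a cone of this slope climbs by
    \<open>2 * c\<close>, from at least \<open>- c\<close> to at least \<open>c\<close>, so far
    apexes cannot pull the minimum below \<open>f\<close>.\<close>
  obtain k where k: "real k > 2 * real c / \<eta>" using reals_Archimedean2 by blast
  have k\<eta>: "real k * \<eta> \<ge> 2 * real c" using k \<eta>(1) by (simp add: field_simps)
  \<comment> \<open>Thirds of \<open>\<epsilon>\<close> pay for the rational apex values, the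
    oscillation of \<open>f\<close> within \<open>\<eta>\<close> and the climb of a cone over the
    mesh \<open>\<delta>\<close>; \<open>\<kappa>\<close> is a visibly positive bound of the slope
    to divide by.\<close>
  define \<kappa> where "\<kappa> = real k + 1"
  have \<kappa>: "\<kappa> > 0" "real k \<le> \<kappa>" by (auto simp: \<kappa>_def)
  define \<delta> where "\<delta> = min \<eta> (\<epsilon> / (3 * \<kappa>))"
  have "\<delta> > 0" using \<eta>(1) \<open>\<epsilon> > 0\<close> \<kappa>(1) by (simp add: \<delta>_def)
  have "real k * \<delta> \<le> \<kappa> * (\<epsilon> / (3 * \<kappa>))"
    using \<open>\<delta> > 0\<close> \<kappa> by (intro mult_mono) (simp_all add: \<delta>_def)
  also have "\<dots> = \<epsilon> / 3" using \<kappa>(1) by simp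
  finally have k\<delta>: "real k * \<delta> \<le> \<epsilon> / 3" .
  obtain C where C: "finite C" "C \<subseteq> L" "L \<subseteq> (\<Union>x\<in>C. mball x \<delta>)"
    using compactin_imp_mtotally_bounded[OF L, unfolded mtotally_bounded_def, rule_format, OF \<open>\<delta> > 0\<close>] by auto
  have "\<exists>a\<in>\<rat>. f p < a \<and> a < f p + \<epsilon> / 3" for p
    using \<open>\<epsilon> > 0\<close> by (intro Rats_dense_in_real) auto
  then obtain a where a: "\<And>p. a p \<in> \<rat>" "\<And>p. f p < a p" "\<And>p. a p < f p + \<epsilon> / 3" by metis
  obtain qs where qs: "set qs = C" using finite_list[OF C(1)] by blast
  define ps where "ps = map (\<lambda>p. (a p, p)) qs"
  have ps: "ps \<in> lists (\<rat> \<times> M)" using a C LM qs by (auto simp: ps_def)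
  define h where "h = (\<lambda>x. max (- real c) (min_cone d (real k) (real c) ps x))"
  show thesis
  proof (rule that[of h])
    show "h \<in> test_functions d M"
      unfolding test_functions_def h_def
      by (rule image_eqI[of _ _ "(c, k, ps)"]) (use ps in auto)
    show "\<bar>h x\<bar> \<le> real c" for x
      using min_cone_le[of d "real k" "real c" ps x] unfolding h_def by auto
    fix x assume x: "x \<in> L"
    then have xM: "x \<in> M" using LM by blast
    obtain p where p: "p \<in> C" "d p x < \<delta>" using C x by auto
    have "d p x < \<eta>" using p(2) by (simp add: \<delta>_def)
    then have "\<bar>f p - f x\<bar> < \<epsilon> / 3" using \<eta>(2) p C xM by blast
    moreover have "min_cone d (real k) (real c) ps x \<le> a p + real k * d p x"
      by (rule min_cone_le_cone) (use p qs in \<open>auto simp: ps_def\<close>)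
    moreover have "real k * d p x \<le> real k * \<delta>" using p(2) by (intro mult_left_mono) auto
    ultimately have "min_cone d (real k) (real c) ps x \<le> f x + \<epsilon>"
      using k\<delta> a(3)[of p] by linarith
    moreover have "f x - \<epsilon> \<le> min_cone d (real k) (real c) ps x"
    proof (rule le_min_cone)
      show "f x - \<epsilon> \<le> real c" using c[OF xM] \<open>\<epsilon> > 0\<close> by linarith
      fix b q assume "(b, q) \<in> set ps"
      then have q: "b = a q" "q \<in> L" using C qs by (auto simp: ps_def)
      show "f x - \<epsilon> \<le> b + real k * d q x"
      proof (cases "d q x < \<eta>")
        case True
        then have "\<bar>f q - f x\<bar> < \<epsilon> / 3" using \<eta>(2) q xM by blast
        moreover have "real k * d q x \<ge> 0" by simp
        ultimately show ?thesis using a(2)[of q] q(1) \<open>\<epsilon> > 0\<close> by linarith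
      next
        case False
        then have "real k * \<eta> \<le> real k * d q x" by (intro mult_left_mono) auto
        moreover have "q \<in> M" using q LM by blast
        ultimately show ?thesis using a(2)[of q] q(1) k\<eta> c[OF xM] c[of q] \<open>\<epsilon> > 0\<close> by linarith
      qed
    qed
    ultimately show "\<bar>f x - h x\<bar> \<le> \<epsilon>"
      using c[OF xM] \<open>\<epsilon> > 0\<close> unfolding h_def by (auto simp: max_def)
  qed
qed

end

section \<open>Divergent sequences of concentrated functionals\<close>

lemma mass_UN_le:
  assumes "finite (supp w)" "finite I"
  shows "mass w (\<Union>j\<in>I. A j) \<le> (\<Sum>j\<in>I. mass w (A j))"
  using assms(2)
proof (induction I)
  case empty
  then show ?case by (simp add: mass_def)
next
  case (insert i I)
  have "mass w (A i \<union> (\<Union>j\<in>I. A j)) \<le> mass w (A i) + mass w (\<Union>j\<in>I. A j)"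
    unfolding mass_def Int_Un_distrib
    by (subst sum_Un) (auto simp: assms(1) sum_nonneg)
  with insert show ?case by simp
qed

text \<open>Countable subadditivity reduced to the finite case: each of the finitely many support
  points outside the intersection picks one index at which it fails, and these indices are bounded
  by \<open>J\<close>.\<close>

lemma mass_Compl_INT_le:
  assumes fin: "finite (supp w)" and le: "\<And>j. mass w (- A j) \<le> (1/2) ^ j"
  shows "mass w (- (\<Inter>j\<in>{k..}. A j)) \<le> 2 * (1/2) ^ k"
proof -
  let ?S = "supp w \<inter> - (\<Inter>j\<in>{k..}. A j)"
  have "\<forall>x\<in>?S. \<exists>j. j \<ge> k \<and> x \<notin> A j" by auto
  then obtain j where j: "\<And>x. x \<in> ?S \<Longrightarrow> j x \<ge> k \<and> x \<notin> A (j x)" by metis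
  obtain J where J: "\<And>x. x \<in> ?S \<Longrightarrow> j x < J"
    using finite_nat_set_iff_bounded[of "j ` ?S"] fin by auto
  have geo: "(\<Sum>j\<in>{k..<J}. (1/2::real) ^ j) \<le> 2 * (1/2) ^ k"
  proof (cases "k \<le> J")
    case True
    then have "(\<Sum>j\<in>{k..<J}. (1/2::real) ^ j) = 2 * (1/2) ^ k - 2 * (1/2) ^ J"
      by (induction J rule: dec_induct) auto
    then show ?thesis by simp
  qed simp
  have "mass w (- (\<Inter>j\<in>{k..}. A j)) \<le> mass w (\<Union>j\<in>{k..<J}. - A j)"
    using j J by (intro mass_mono[OF fin]) fastforce
  also have "\<dots> \<le> (\<Sum>j\<in>{k..<J}. mass w (- A j))" by (rule mass_UN_le[OF fin]) simp
  also have "\<dots> \<le> (\<Sum>j\<in>{k..<J}. (1/2) ^ j)" by (rule sum_mono) (rule le)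
  also note geo
  finally show ?thesis .
qed

section \<open>Compact sets cut out by finite nets at every scale\<close>

context Metric_space begin

lemma locally_finite_range:
  assumes y: "range y \<subseteq> M" and lf: "\<And>q. q \<in> M \<Longrightarrow> \<exists>r>0. finite {n. d q (y n) < r}"
  shows "closedin mtopology (range y)" "x \<in> range y \<Longrightarrow> openin (subtopology mtopology (range y)) {x}"
proof -
  have "q \<notin> mtopology derived_set_of range y" for q
  proof
    assume q: "q \<in> mtopology derived_set_of range y"
    then have "q \<in> M" using derived_set_of_subset_topspace by fastforce
    then obtain r where r: "r > 0" "finite {n. d q (y n) < r}" using lf by blast
    have "range y \<inter> mball q r \<subseteq> y ` {n. d q (y n) < r}" by auto
    then have "finite (range y \<inter> mball q r)" using r finite_surj by blast
    then show False using q r by (auto simp: derived_set_of_infinite_mball)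
  qed
  then have der: "mtopology derived_set_of range y = {}" by blast
  then show "closedin mtopology (range y)"
    using y by (simp add: closedin_contains_derived_set)
  have "subtopology mtopology (range y) = discrete_topology (range y)"
    using y der by (simp add: subtopology_eq_discrete_topology_eq)
  then show "x \<in> range y \<Longrightarrow> openin (subtopology mtopology (range y)) {x}"
    by simp
qed

text \<open>For fixed \<open>j\<close> this is the exhaustion used by the gliding hump: closed,
  increasing in \<open>m\<close>, with interiors covering a countable \<open>M\<close>. One such set
  from each scale yields total boundedness.\<close>

definition net_cover :: "nat \<Rightarrow> nat \<Rightarrow> 'a set" where
  "net_cover j m = (\<Union>i\<le>m. mcball (from_nat_into M i) ((1/2) ^ j))"

lemma closedin_net_cover: "closedin mtopology (net_cover j m)"
  unfolding net_cover_def by (intro closedin_Union) auto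

lemma net_cover_mono: "m \<le> m' \<Longrightarrow> net_cover j m \<subseteq> net_cover j m'"
  unfolding net_cover_def by (intro UN_mono) auto

lemma net_cover_interior:
  assumes "countable M" shows "M \<subseteq> (\<Union>m. mtopology interior_of net_cover j m)"
proof
  fix x assume x: "x \<in> M"
  then obtain i where i: "from_nat_into M i = x" using from_nat_into_surj[OF assms x] by blast
  have "mball x ((1/2) ^ j) \<subseteq> net_cover j i"
    unfolding net_cover_def using i mball_subset_mcball by blast
  then have "mball x ((1/2) ^ j) \<subseteq> mtopology interior_of net_cover j i"
    by (rule interior_of_maximal) simp
  moreover have "x \<in> mball x ((1/2) ^ j)" using x by simp
  ultimately show "x \<in> (\<Union>m. mtopology interior_of net_cover j m)" by blast
qed

lemma compactin_INT_net_cover: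
  assumes "mcomplete" shows "compactin mtopology (\<Inter>j\<in>{k..}. net_cover j (s j))"
proof (rule compactin_if_finite_covers[OF assms])
  show "closedin mtopology (\<Inter>j\<in>{k..}. net_cover j (s j))"
    by (intro closedin_Inter) (auto simp: closedin_net_cover)
  fix \<epsilon> :: real assume "\<epsilon> > 0"
  then obtain i where i: "(1/2::real) ^ i < \<epsilon>" using real_arch_pow_inv[of \<epsilon> "1/2"] by auto
  \<comment> \<open>Only scales from \<open>k\<close> on take part in the intersection, hence
    \<open>max i k\<close>.\<close>
  have "(1/2::real) ^ (max i k) \<le> (1/2) ^ i" by (rule power_decreasing) auto
  with i have le: "(1/2::real) ^ (max i k) \<le> \<epsilon>" by linarith
  have "net_cover (max i k) m \<subseteq> (\<Union>c\<in>from_nat_into M ` {..m}. mcball c \<epsilon>)" for m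
    unfolding net_cover_def using mcball_subset_concentric[OF le] by fast
  then have "(\<Inter>j\<in>{k..}. net_cover j (s j)) \<subseteq> (\<Union>c\<in>from_nat_into M ` {..s (max i k)}. mcball c \<epsilon>)"
    by fastforce
  then show "\<exists>C. finite C \<and> (\<Inter>j\<in>{k..}. net_cover j (s j)) \<subseteq> (\<Union>c\<in>C. mcball c \<epsilon>)"
    by (intro exI[of _ "from_nat_into M ` {..s (max i k)}"]) simp
qed

end

text \<open>What remains after restriction to \<open>K\<close> and \<open>Z\<close>. The operator
  survives only as the map from \<open>f\<close> to \<open>\<lambda>y. pairing (w y) f\<close>;
  which functions it keeps continuous or bounded is left to the lemmas, so both function spaces
  share one setting.\<close>

locale finitely_supported_functionals = X: Metric_space M d + Y: Metric_space N e
  for M :: "'a set" and d and N :: "'b set" and e +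
  fixes w :: "'b \<Rightarrow> 'a \<Rightarrow> real"
  assumes X_complete: "X.mcomplete" and X_countable: "countable M"
    and Y_countable: "countable N" and Y_nonempty: "N \<noteq> {}"
    and Y_crowded: "\<And>q r. q \<in> N \<Longrightarrow> r > 0 \<Longrightarrow> \<exists>z\<in>N. z \<noteq> q \<and> e q z < r"
    and finite_supp: "\<And>y. y \<in> N \<Longrightarrow> finite (supp (w y))"
    and supp_subset: "\<And>y. y \<in> N \<Longrightarrow> supp (w y) \<subseteq> M"
begin

text \<open>If concentration failed near \<open>q\<close>, functionals at points tending to
  \<open>q\<close> would be heavy outside every net, and a gliding hump \<open>f\<close> vanishing
  on \<open>supp (w q)\<close> would give pairings of modulus at least 1/2 arbitrarily near
  \<open>q\<close>, where the pairing is 0. The size condition in \<open>cont\<close> fits both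
  spaces: a weight depending on \<open>j\<close> alone involves only bounded
  \<open>f\<close>.\<close>

lemma concentrated_divergent_sequence:
  fixes \<sigma> :: "nat \<Rightarrow> 'b \<Rightarrow> real"
  assumes nonneg: "\<And>j y. 0 \<le> \<sigma> j y"
    and cont: "\<And>f j. continuous_map X.mtopology euclideanreal f \<Longrightarrow>
      (\<And>x. x \<in> M \<Longrightarrow> f x = 0 \<or> (\<exists>y\<in>N. \<bar>f x\<bar> \<le> \<sigma> j y)) \<Longrightarrow>
      continuous_map Y.mtopology euclideanreal (\<lambda>y. pairing (w y) f)"
  shows "\<exists>(y :: nat \<Rightarrow> 'b) s. range y \<subseteq> N \<and> inj y \<and> (\<forall>q\<in>N. \<exists>r>0. finite {n. e q (y n) < r}) \<and>
    (\<forall>j n. \<sigma> j (y n) * mass (w (y n)) (- X.net_cover j (s j)) \<le> 1)"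
proof -
  \<comment> \<open>The guard \<open>y \<in> N\<close> is there because monotonicity is demanded at
    every \<open>y\<close>, while supports are known to be finite only over
    \<open>N\<close>.\<close>
  define P where "P = (\<lambda>j m y. y \<in> N \<longrightarrow> \<sigma> j y * mass (w y) (- X.net_cover j m) \<le> 1)"
  have mono: "P j m' y" if "m \<le> m'" "P j m y" for j m m' y
  proof -
    have "\<sigma> j y * mass (w y) (- X.net_cover j m') \<le> \<sigma> j y * mass (w y) (- X.net_cover j m)" if "y \<in> N"
      using X.net_cover_mono[OF \<open>m \<le> m'\<close>]
      by (intro mult_left_mono mass_mono[OF finite_supp[OF that]] nonneg) auto
    then show ?thesis using that(2) unfolding P_def by force
  qed
  have loc: "\<exists>r>0. \<exists>m. \<forall>z\<in>N. e q z < r \<longrightarrow> P j m z" if q: "q \<in> N" for q j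
  proof (rule ccontr)
    assume neg: "\<not> ?thesis"
    have "\<exists>z. z \<in> N \<and> e q z < inverse (real (Suc m)) \<and> 1 < \<sigma> j z * mass (w z) (- X.net_cover j m)" for m
    proof -
      have "inverse (real (Suc m)) > 0" by simp
      with neg have "\<exists>z\<in>N. e q z < inverse (real (Suc m)) \<and> \<not> P j m z" by blast
      then show ?thesis unfolding P_def by (auto simp: not_le)
    qed
    then obtain z where z: "\<And>m. z m \<in> N" "\<And>m. e q (z m) < inverse (real (Suc m))"
      "\<And>m. 1 < \<sigma> j (z m) * mass (w (z m)) (- X.net_cover j m)" by metis
    obtain f where f: "continuous_map X.mtopology euclideanreal f"
      "\<And>x. x \<in> topspace X.mtopology \<Longrightarrow> f x = 0 \<or> (\<exists>k. \<bar>f x\<bar> \<le> \<bar>\<sigma> j (z k)\<bar>)"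
      "\<And>x. x \<in> supp (w q) \<Longrightarrow> f x = 0" "infinite {k. 1/2 \<le> \<bar>pairing (w (z k)) f\<bar>}"
    proof (rule gliding_hump[of X.mtopology "X.net_cover j" "\<lambda>k. w (z k)" "supp (w q)" "\<lambda>k. \<sigma> j (z k)"])
      show "metrizable_space X.mtopology" by (rule X.metrizable_space_mtopology)
      show "closedin X.mtopology (X.net_cover j m)" for m by (rule X.closedin_net_cover)
      show "X.net_cover j m \<subseteq> X.net_cover j (Suc m)" for m by (rule X.net_cover_mono) simp
      show "topspace X.mtopology \<subseteq> (\<Union>m. X.mtopology interior_of X.net_cover j m)"
        using X.net_cover_interior[OF X_countable] by simp
      show "\<exists>k. 1 < \<sigma> j (z k) * mass (w (z k)) (- X.net_cover j m)" for m
        using z(3) by blast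
    qed (use z(1) q finite_supp supp_subset in auto)
    have "continuous_map Y.mtopology euclideanreal (\<lambda>y. pairing (w y) f)"
    proof (rule cont[OF f(1), of j])
      fix x assume "x \<in> M"
      then have "f x = 0 \<or> (\<exists>k. \<bar>f x\<bar> \<le> \<bar>\<sigma> j (z k)\<bar>)" using f(2) by simp
      then show "f x = 0 \<or> (\<exists>y\<in>N. \<bar>f x\<bar> \<le> \<sigma> j y)"
        using z(1) nonneg by (metis abs_of_nonneg)
    qed
    then obtain \<delta> where \<delta>: "\<delta> > 0"
      "\<forall>y. y \<in> N \<and> e q y < \<delta> \<longrightarrow> \<bar>pairing (w q) f - pairing (w y) f\<bar> < 1/2"
      unfolding Y.continuous_map_real_iff using q by (meson half_gt_zero zero_less_one)
    have "pairing (w q) f = 0" using f(3) by (simp add: pairing_def)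
    obtain k0 where k0: "inverse (real (Suc k0)) < \<delta>" using reals_Archimedean[OF \<delta>(1)] by auto
    have "{k. 1/2 \<le> \<bar>pairing (w (z k)) f\<bar>} \<subseteq> {..k0}"
    proof (intro subsetI, rule ccontr)
      fix k assume k: "k \<in> {k. 1/2 \<le> \<bar>pairing (w (z k)) f\<bar>}" "k \<notin> {..k0}"
      then have "inverse (real (Suc k)) \<le> inverse (real (Suc k0))"
        by (intro le_imp_inverse_le) auto
      then have "e q (z k) < \<delta>" using z(2)[of k] k0 by linarith
      then have "\<bar>pairing (w q) f - pairing (w (z k)) f\<bar> < 1/2" using \<delta>(2) z(1) by blast
      then show False using k(1) \<open>pairing (w q) f = 0\<close> by simp
    qed
    then show False using f(4) finite_subset by blast
  qed
  show ?thesis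
  proof (rule Y.divergent_sequence_in_countable_crowded[of P, OF Y_nonempty Y_countable])
    fix y :: "nat \<Rightarrow> 'b" and s assume y: "range y \<subseteq> N" "inj y" "\<And>q. q \<in> N \<Longrightarrow> \<exists>r>0. finite {n. e q (y n) < r}"
      "\<And>j n. P j (s j) (y n)"
    have le: "\<sigma> j (y n) * mass (w (y n)) (- X.net_cover j (s j)) \<le> 1" for j n
      using y(1) y(4)[of j n] unfolding P_def by blast
    show ?thesis
      by (rule exI[of _ y], rule exI[of _ s]) (intro conjI ballI allI y(1) y(2) y(3) le)
  qed (erule (1) Y_crowded, erule (1) mono, erule loc)
qed

text \<open>A suitable weight \<open>\<sigma>\<close> turns a bound on mass into a statement about
  supports, so all measures along the sequence live in one compact \<open>L\<close>. If
  \<open>f\<close> is bounded by \<open>B\<close> there, its pairings are at most \<open>B\<close>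
  times the total mass, a growth that \<open>g\<close> is made to beat.\<close>

lemma not_onto_continuous:
  assumes cont: "\<And>f. continuous_map X.mtopology euclideanreal f \<Longrightarrow>
      continuous_map Y.mtopology euclideanreal (\<lambda>y. pairing (w y) f)"
  shows "\<exists>g. continuous_map Y.mtopology euclideanreal g \<and>
    (\<forall>f. continuous_map X.mtopology euclideanreal f \<longrightarrow> (\<exists>y\<in>N. pairing (w y) f \<noteq> g y))"
proof -
  have "\<exists>s\<ge>0. \<forall>x\<in>supp (w y). 1 < s * \<bar>w y x\<bar>" if "y \<in> N" for y
  proof (intro exI conjI ballI)
    \<comment> \<open>This sum dominates every \<open>2 / \<bar>w y x\<bar>\<close>, so a single
      support point outside a net already violates the bound 1.\<close>
    let ?s = "\<Sum>x\<in>supp (w y). 2 / \<bar>w y x\<bar>"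
    show "0 \<le> ?s" by (intro sum_nonneg) auto
    fix x assume x: "x \<in> supp (w y)"
    then have "2 / \<bar>w y x\<bar> \<le> ?s"
      by (intro member_le_sum) (auto simp: finite_supp[OF that])
    then have "2 / \<bar>w y x\<bar> * \<bar>w y x\<bar> \<le> ?s * \<bar>w y x\<bar>" by (intro mult_right_mono) auto
    then show "1 < ?s * \<bar>w y x\<bar>" using x by simp
  qed
  then have "\<forall>y. \<exists>s\<ge>0. y \<in> N \<longrightarrow> (\<forall>x\<in>supp (w y). 1 < s * \<bar>w y x\<bar>)" by (meson order_refl)
  then obtain \<sigma> where \<sigma>0: "\<And>y. \<sigma> y \<ge> 0" and \<sigma>: "\<And>y x. y \<in> N \<Longrightarrow> x \<in> supp (w y) \<Longrightarrow> 1 < \<sigma> y * \<bar>w y x\<bar>"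
    by metis
  have "\<exists>(y :: nat \<Rightarrow> 'b) s. range y \<subseteq> N \<and> inj y \<and> (\<forall>q\<in>N. \<exists>r>0. finite {n. e q (y n) < r}) \<and>
      (\<forall>j n. \<sigma> (y n) * mass (w (y n)) (- X.net_cover j (s j)) \<le> 1)"
    by (rule concentrated_divergent_sequence[of "\<lambda>j. \<sigma>"]) (rule \<sigma>0, erule cont)
  then obtain y :: "nat \<Rightarrow> 'b" and s
    where y: "range y \<subseteq> N" "inj y" "\<forall>q\<in>N. \<exists>r>0. finite {n. e q (y n) < r}"
      and ms: "\<forall>j n. \<sigma> (y n) * mass (w (y n)) (- X.net_cover j (s j)) \<le> 1"
    by (elim exE conjE)
  have yN: "y n \<in> N" for n using y(1) by blast
  define L where "L = (\<Inter>j\<in>{0..}. X.net_cover j (s j))"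
  have L: "compactin X.mtopology L" unfolding L_def by (rule X.compactin_INT_net_cover[OF X_complete])
  have suppL: "supp (w (y n)) \<subseteq> L" for n
  proof
    fix x assume x: "x \<in> supp (w (y n))"
    have "x \<in> X.net_cover j (s j)" for j
    proof (rule ccontr)
      assume "x \<notin> X.net_cover j (s j)"
      then have "\<bar>w (y n) x\<bar> \<le> mass (w (y n)) (- X.net_cover j (s j))"
        unfolding mass_def using x finite_supp[OF yN]
        by (intro member_le_sum) auto
      then have "\<sigma> (y n) * \<bar>w (y n) x\<bar> \<le> 1"
        using ms[rule_format, of n j] \<sigma>0[of "y n"] by (meson mult_left_mono order_trans)
      then show False using \<sigma>[OF yN x] by simp
    qed
    then show "x \<in> L" by (simp add: L_def)
  qed
  \<comment> \<open>The factor \<open>real n\<close> beats every bound of \<open>f\<close> on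
    \<open>L\<close>; the summand 1 covers the case of zero mass.\<close>
  define t where "t = (\<lambda>n. real n * (1 + mass (w (y n)) UNIV))"
  obtain g where g: "continuous_map Y.mtopology euclideanreal g" "\<And>z. z \<in> range y \<Longrightarrow> g z = t (inv y z)"
    by (rule extension_from_discrete[of Y.mtopology "range y" "{}" UNIV "\<lambda>z. t (inv y z)"])
      (use Y.locally_finite_range[OF y(1) bspec[OF y(3)]] in
        \<open>auto intro: metrizable_imp_normal_space Y.metrizable_space_mtopology\<close>)
  have "\<exists>y\<in>N. pairing (w y) f \<noteq> g y" if f: "continuous_map X.mtopology euclideanreal f" for f
  proof (rule ccontr)
    assume "\<not> ?thesis"
    then have eq: "pairing (w (y n)) f = t n" for n
      using yN g(2)[of "y n"] inv_f_f[OF y(2)] by auto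
    have "compactin euclideanreal (f ` L)" by (rule image_compactin[OF L f])
    then have "bounded (f ` L)" by (simp add: compact_imp_bounded)
    then obtain B where B: "\<forall>x\<in>L. \<bar>f x\<bar> \<le> B" by (auto simp: bounded_iff)
    have "real n \<le> \<bar>B\<bar>" for n
    proof -
      define S where "S = mass (w (y n)) UNIV"
      have "S \<ge> 0" unfolding S_def by (rule mass_nonneg)
      have "\<bar>pairing (w (y n)) f\<bar> \<le> \<bar>B\<bar> * S"
        unfolding S_def using suppL[of n] B
        by (intro abs_pairing_le_mass finite_supp yN) force
      then have "real n * (1 + S) \<le> \<bar>B\<bar> * S"
        unfolding eq t_def S_def[symmetric] by linarith
      also have "\<dots> \<le> \<bar>B\<bar> * (1 + S)" by (intro mult_left_mono) auto
      finally show ?thesis using \<open>S \<ge> 0\<close> by simp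
    qed
    then show False using reals_Archimedean2[of "\<bar>B\<bar>"] by (meson not_le)
  qed
  then show ?thesis using g(1) by blast
qed

text \<open>The supports need not lie in one compact set; what holds is tightness, the mass outside
  the compact \<open>L k\<close> being at most \<open>2 * (1/2) ^ k\<close> for all terms. With a
  norm bound this is the situation of Prokhorov's theorem, and a diagonal subsequence over the test
  functions plays the part of weak compactness.\<close>

lemma not_onto_bounded_continuous:
  assumes cont: "\<And>f. continuous_map X.mtopology euclideanreal f \<Longrightarrow> bounded (f ` M) \<Longrightarrow>
      continuous_map Y.mtopology euclideanreal (\<lambda>y. pairing (w y) f)"
    and bdd: "\<And>f. continuous_map X.mtopology euclideanreal f \<Longrightarrow> bounded (f ` M) \<Longrightarrow>
      bounded ((\<lambda>y. pairing (w y) f) ` N)"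
  shows "\<exists>g. continuous_map Y.mtopology euclideanreal g \<and> bounded (g ` N) \<and>
    (\<forall>f. continuous_map X.mtopology euclideanreal f \<and> bounded (f ` M) \<longrightarrow> (\<exists>y\<in>N. pairing (w y) f \<noteq> g y))"
proof -
  have cont': "continuous_map Y.mtopology euclideanreal (\<lambda>y. pairing (w y) f)"
    if "continuous_map X.mtopology euclideanreal f"
      "\<And>x. x \<in> M \<Longrightarrow> f x = 0 \<or> (\<exists>y\<in>N. \<bar>f x\<bar> \<le> 2 ^ j)" for f and j :: nat
  proof (rule cont[OF that(1)])
    show "bounded (f ` M)"
      unfolding bounded_iff using that(2) by (intro exI[of _ "2 ^ j"]) force
  qed
  have "\<exists>(y :: nat \<Rightarrow> 'b) s. range y \<subseteq> N \<and> inj y \<and> (\<forall>q\<in>N. \<exists>r>0. finite {n. e q (y n) < r}) \<and>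
      (\<forall>j n. 2 ^ j * mass (w (y n)) (- X.net_cover j (s j)) \<le> 1)"
    by (rule concentrated_divergent_sequence[of "\<lambda>j y. 2 ^ j"]) (simp, erule cont')
  then obtain y :: "nat \<Rightarrow> 'b" and s
    where y: "range y \<subseteq> N" "inj y" "\<forall>q\<in>N. \<exists>r>0. finite {n. e q (y n) < r}"
      and ms: "\<forall>j n. 2 ^ j * mass (w (y n)) (- X.net_cover j (s j)) \<le> 1"
    by (elim exE conjE)
  have yN: "y n \<in> N" for n using y(1) by blast
  define L where "L = (\<lambda>k::nat. \<Inter>j\<in>{k..}. X.net_cover j (s j))"
  have L: "compactin X.mtopology (L k)" for k
    unfolding L_def by (rule X.compactin_INT_net_cover[OF X_complete])
  have massL: "mass (w (y n)) (- L k) \<le> 2 * (1/2) ^ k" for n k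
    unfolding L_def
  proof (rule mass_Compl_INT_le[OF finite_supp[OF yN]])
    show "mass (w (y n)) (- X.net_cover j (s j)) \<le> (1/2) ^ j" for j
      using ms[rule_format, of j n] by (simp add: field_simps)
  qed
  have seq_bdd: "bounded (range (\<lambda>n. pairing (w (y n)) f))"
    if "continuous_map X.mtopology euclideanreal f" "bounded (f ` M)" for f
    by (rule bounded_subset[OF bdd[OF that]]) (use yN in auto)
  obtain B where B: "\<And>n. mass (w (y n)) UNIV \<le> B"
  proof (rule uniform_boundedness[of X.mtopology "\<lambda>n. w (y n)"])
    show "metrizable_space X.mtopology" by (rule X.metrizable_space_mtopology)
  qed (use seq_bdd finite_supp[OF yN] supp_subset[OF yN] in auto)
  let ?H = "test_functions d M"
  have "?H \<noteq> {}" unfolding test_functions_def by auto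
  define h where "h = from_nat_into ?H"
  have hH: "h i \<in> ?H" for i unfolding h_def using \<open>?H \<noteq> {}\<close> by (rule from_nat_into)
  obtain r where r: "strict_mono r" "\<And>i. convergent (\<lambda>n. pairing (w (y (r n))) (h i))"
    by (rule diagonal_convergent_subsequence[of "\<lambda>i n. pairing (w (y n)) (h i)"])
      (use seq_bdd X.test_functions_continuous_bounded[OF hH] in blast)+
  \<comment> \<open>The subsequence \<open>r\<close> was chosen by the test functions alone, so
    \<open>g\<close> is free to alternate along it; all other points receive \<open>- 1\<close> as a
    filler.\<close>
  define t where "t = (\<lambda>z. if \<exists>n. even n \<and> z = y (r n) then 1 else - 1 :: real)"
  obtain g where g: "continuous_map Y.mtopology euclideanreal g" "g ` topspace Y.mtopology \<subseteq> {-1..1}"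
    "\<And>z. z \<in> range y \<Longrightarrow> g z = t z"
    by (rule extension_from_discrete[of Y.mtopology "range y" "{}" "{-1..1}" t])
      (use Y.locally_finite_range[OF y(1) bspec[OF y(3)]] in
        \<open>auto intro: metrizable_imp_normal_space Y.metrizable_space_mtopology
          simp: is_interval_cc t_def\<close>)
  have gt: "g (y (r n)) = (if even n then 1 else - 1)" for n
    using g(3)[of "y (r n)"] inj_eq[OF y(2)] strict_mono_eq[OF r(1)] by (simp add: t_def)
  have "bounded (g ` N)"
    using g(2) bounded_closed_interval bounded_subset Y.topspace_mtopology by metis
  moreover have "\<exists>y\<in>N. pairing (w y) f \<noteq> g y"
    if f: "continuous_map X.mtopology euclideanreal f" "bounded (f ` M)" for f
  proof (rule ccontr)
    assume "\<not> ?thesis"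
    then have eq: "pairing (w (y (r n))) f = (if even n then 1 else - 1)" for n
      using yN gt by auto
    obtain b where b: "\<And>x. x \<in> M \<Longrightarrow> \<bar>f x\<bar> \<le> b" using f(2) by (auto simp: bounded_iff)
    obtain c :: nat where "b \<le> real c" using real_arch_simple by blast
    then have c: "\<bar>f x\<bar> \<le> real c" if "x \<in> M" for x using b[OF that] by linarith
    \<comment> \<open>The mass outside \<open>L k\<close> will cost at most
      \<open>2 * c * (2 * (1/2) ^ k)\<close>, which this choice keeps below 1/4; the choice of
      \<open>\<epsilon>\<close> allots another 1/4 to \<open>L k\<close> itself.\<close>
    obtain k where k: "(1/2::real) ^ k < 1 / (16 * (real c + 1))"
      using real_arch_pow_inv[of "1 / (16 * (real c + 1))" "1/2"] by auto
    have k': "2 * real c * (2 * (1/2) ^ k) \<le> 1/4"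
    proof -
      have "(real c + 1) * (1/2) ^ k \<le> 1 / 16"
        using k by (simp add: field_simps)
      moreover have "real c * (1/2) ^ k \<le> (real c + 1) * (1/2) ^ k" by (intro mult_right_mono) auto
      ultimately show ?thesis by linarith
    qed
    define \<epsilon> where "\<epsilon> = 1 / (4 * (\<bar>B\<bar> + 1))"
    have "\<epsilon> > 0" by (simp add: \<epsilon>_def)
    obtain h' where h': "h' \<in> ?H" "\<And>x. \<bar>h' x\<bar> \<le> real c" "\<And>x. x \<in> L k \<Longrightarrow> \<bar>f x - h' x\<bar> \<le> \<epsilon>"
      by (rule X.test_functions_approximate[OF L f(1) _ \<open>\<epsilon> > 0\<close>]) (erule c, rule that)
    have close: "\<bar>pairing (w (y n)) f - pairing (w (y n)) h'\<bar> \<le> 1/2" for n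
    proof -
      have "\<bar>pairing (w (y n)) f - pairing (w (y n)) h'\<bar>
          \<le> \<epsilon> * mass (w (y n)) (L k) + 2 * real c * mass (w (y n)) (- L k)"
        unfolding pairing_diff[symmetric]
      proof (rule abs_pairing_le[OF finite_supp[OF yN]])
        fix x assume "w (y n) x \<noteq> 0" "x \<notin> L k"
        then have "x \<in> M" using supp_subset[OF yN] by blast
        then show "\<bar>f x - h' x\<bar> \<le> 2 * real c" using c[of x] h'(2)[of x] by linarith
      qed (rule h'(3))
      also have "\<dots> \<le> \<epsilon> * \<bar>B\<bar> + 2 * real c * (2 * (1/2) ^ k)"
      proof (intro add_mono mult_left_mono massL)
        show "mass (w (y n)) (L k) \<le> \<bar>B\<bar>"
          using mass_mono[OF finite_supp[OF yN] subset_UNIV, of n "L k"] B[of n] by linarith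
      qed (use \<open>\<epsilon> > 0\<close> in auto)
      also have "\<epsilon> * \<bar>B\<bar> \<le> 1/4" by (simp add: \<epsilon>_def field_simps)
      finally show ?thesis using k' by linarith
    qed
    obtain i where "h i = h'"
      using from_nat_into_surj[OF countable_test_functions[OF X_countable] h'(1)] by (auto simp: h_def)
    then have "Cauchy (\<lambda>n. pairing (w (y (r n))) h')" using r(2)[of i] by (simp add: Cauchy_convergent_iff)
    then obtain n0 where n0: "\<And>m n. m \<ge> n0 \<Longrightarrow> n \<ge> n0 \<Longrightarrow>
        dist (pairing (w (y (r m))) h') (pairing (w (y (r n))) h') < 1/2"
      unfolding Cauchy_def by (meson half_gt_zero zero_less_one)
    \<comment> \<open>An even and an odd index from \<open>n0\<close> on: the pairings with
      \<open>f\<close> differ by 2, those with \<open>h'\<close> by less than 1/2, and each is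
      within 1/2 of its counterpart.\<close>
    have "\<bar>pairing (w (y (r (2 * n0)))) h' - pairing (w (y (r (2 * n0 + 1)))) h'\<bar> < 1/2"
      using n0[of "2 * n0" "2 * n0 + 1"] by (simp add: dist_real_def)
    moreover have "pairing (w (y (r (2 * n0)))) f = 1" "pairing (w (y (r (2 * n0 + 1)))) f = - 1"
      using eq[of "2 * n0"] eq[of "2 * n0 + 1"] by simp_all
    ultimately show False
      using close[of "r (2 * n0)"] close[of "r (2 * n0 + 1)"] by linarith
  qed
  ultimately show ?thesis using g(1) by blast
qed

end

section \<open>Reduction to countable spaces\<close>

lemma scattered_space_subtopology:
  assumes "scattered_space X"
  shows "scattered_space (subtopology X S)"
  unfolding scattered_space_def
proof (intro allI impI)
  fix A assume A: "A \<subseteq> topspace (subtopology X S) \<and> A \<noteq> {}"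
  then have "S \<inter> A = A" by auto
  then have "subtopology (subtopology X S) A = subtopology X A"
    by (simp add: subtopology_subtopology)
  moreover have "\<exists>x\<in>A. openin (subtopology X A) {x}"
    using assms A unfolding scattered_space_def by auto
  ultimately show "\<exists>x\<in>A. openin (subtopology (subtopology X S) A) {x}" by simp
qed

text \<open>For every \<open>x\<close> in a crowded set \<open>A\<close> and every \<open>n\<close>
  a neighbour \<open>\<phi> x n\<close> at distance below \<open>inverse (real (Suc n))\<close> is
  fixed; \<open>Q\<close> is the orbit of one point under these choices, countable because finite
  lists of naturals address it.\<close>

lemma countable_crowded_if_not_scattered:
  assumes Y: "metrizable_space Y" and ns: "\<not> scattered_space Y"
  obtains Q where "countable Q" "Q \<noteq> {}" "Q \<subseteq> topspace Y"
    "\<And>U q. openin Y U \<Longrightarrow> q \<in> Q \<Longrightarrow> q \<in> U \<Longrightarrow> \<exists>z\<in>Q. z \<in> U \<and> z \<noteq> q"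
proof -
  obtain A where A: "A \<subseteq> topspace Y" "A \<noteq> {}" "\<And>x. x \<in> A \<Longrightarrow> \<not> openin (subtopology Y A) {x}"
    using ns unfolding scattered_space_def by blast
  obtain M d where Md: "Metric_space M d" and YM: "Y = Metric_space.mtopology M d"
    using Y by (auto simp: metrizable_space_def)
  interpret Metric_space M d by (rule Md)
  have AM: "A \<subseteq> M" using A(1) by (simp add: YM)
  have "\<exists>z. z \<in> A \<and> z \<noteq> x \<and> d x z < inverse (real (Suc n))" if x: "x \<in> A" for x and n :: nat
  proof (rule ccontr)
    assume neg: "\<nexists>z. z \<in> A \<and> z \<noteq> x \<and> d x z < inverse (real (Suc n))"
    have "x \<in> M" using x AM by blast
    then have "{x} = mball x (inverse (real (Suc n))) \<inter> A"
      using neg x AM by auto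
    then have "openin (subtopology Y A) {x}"
      unfolding openin_subtopology YM using openin_mball by blast
    then show False using A(3) x by blast
  qed
  then have "\<forall>x n. \<exists>z. x \<in> A \<longrightarrow> z \<in> A \<and> z \<noteq> x \<and> d x z < inverse (real (Suc n))" by blast
  then obtain \<phi> where \<phi>: "\<And>x n. x \<in> A \<Longrightarrow> \<phi> x n \<in> A \<and> \<phi> x n \<noteq> x \<and> d x (\<phi> x n) < inverse (real (Suc n))"
    by metis
  obtain a where a: "a \<in> A" using A(2) by blast
  define g where "g = (\<lambda>ns. foldr (\<lambda>n x. \<phi> x n) ns a)"
  have gA: "g ns \<in> A" for ns
    by (induction ns) (auto simp: g_def a \<phi>)
  show thesis
  proof (rule that[of "range g"])
    show "countable (range g)" by simp
    show "range g \<subseteq> topspace Y" using gA A(1) by blast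
    fix U q assume U: "openin Y U" and q: "q \<in> range g" "q \<in> U"
    then obtain ns where ns: "q = g ns" by blast
    obtain r where r: "r > 0" "mball q r \<subseteq> U" using U q(2) by (auto simp: YM openin_mtopology)
    obtain n where n: "inverse (real (Suc n)) < r" using reals_Archimedean[OF r(1)] by blast
    have g: "g (n # ns) = \<phi> q n" by (simp add: g_def ns)
    have "q \<in> A" using gA ns by simp
    then have "g (n # ns) \<noteq> q" "d q (g (n # ns)) < r" using \<phi>[of q n] n g by auto
    moreover have "q \<in> M" "g (n # ns) \<in> M" using \<open>q \<in> A\<close> gA AM by auto
    ultimately show "\<exists>z\<in>range g. z \<in> U \<and> z \<noteq> q" using r(2) by auto
  qed auto
qed

section \<open>Closure properties of the two function spaces\<close>

lemma restrict_in_bdd_cont_funs: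
  assumes "continuous_map X euclideanreal u" "bounded (u ` topspace X)"
  shows "(\<lambda>x\<in>topspace X. u x) \<in> bdd_cont_funs X"
proof -
  have "continuous_map X euclideanreal (\<lambda>x\<in>topspace X. u x)"
    by (rule continuous_map_eq[OF assms(1)]) simp
  moreover have "(\<lambda>x\<in>topspace X. u x) ` topspace X = u ` topspace X" by auto
  ultimately show ?thesis using assms(2) by (auto simp: bdd_cont_funs_def cont_funs_def)
qed

lemma restrict_in_cont_funs:
  assumes "continuous_map X euclideanreal u"
  shows "(\<lambda>x\<in>topspace X. u x) \<in> cont_funs X"
  unfolding cont_funs_def using continuous_map_eq[OF assms, of "\<lambda>x\<in>topspace X. u x"] by auto

lemma cont_funs_add:
  assumes "f \<in> cont_funs X" "g \<in> cont_funs X"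
  shows "(\<lambda>x\<in>topspace X. f x + g x) \<in> cont_funs X"
  using assms by (intro restrict_in_cont_funs continuous_map_add) (auto simp: cont_funs_def)

lemma cont_funs_scale:
  assumes "f \<in> cont_funs X"
  shows "(\<lambda>x\<in>topspace X. c * f x) \<in> cont_funs X"
  using assms by (intro restrict_in_cont_funs continuous_map_real_mult) (auto simp: cont_funs_def)

lemma bdd_cont_funs_add:
  assumes "f \<in> bdd_cont_funs X" "g \<in> bdd_cont_funs X"
  shows "(\<lambda>x\<in>topspace X. f x + g x) \<in> bdd_cont_funs X"
  using assms
  by (intro restrict_in_bdd_cont_funs continuous_map_add bounded_plus_comp)
    (auto simp: bdd_cont_funs_def cont_funs_def)

lemma bdd_cont_funs_scale:
  assumes "f \<in> bdd_cont_funs X"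
  shows "(\<lambda>x\<in>topspace X. c * f x) \<in> bdd_cont_funs X"
proof -
  obtain b where b: "\<forall>x\<in>topspace X. \<bar>f x\<bar> \<le> b" using assms by (auto simp: bdd_cont_funs_def bounded_iff)
  have "bounded ((\<lambda>x. c * f x) ` topspace X)"
    unfolding bounded_iff using b by (intro exI[of _ "\<bar>c\<bar> * b"]) (auto simp: abs_mult mult_left_mono)
  then show ?thesis
    using assms by (intro restrict_in_bdd_cont_funs continuous_map_real_mult)
      (auto simp: bdd_cont_funs_def cont_funs_def)
qed

text \<open>Continuity at zero gives a finite \<open>F\<close> such that functions vanishing on
  \<open>F\<close> have values of modulus below 1, hence 0 by scaling. So the functional depends
  only on the values on \<open>F\<close>, and bumps \<open>e p\<close> dual to the points of
  \<open>F\<close> read off the weights. \<open>D\<close> contains the bounded functions, so bumps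
  are at hand for both spaces.\<close>

lemma finite_support_representation:
  assumes X: "metrizable_space X"
    and D: "bdd_cont_funs X \<subseteq> D" "D \<subseteq> cont_funs X"
    and add: "\<And>f g. f \<in> D \<Longrightarrow> g \<in> D \<Longrightarrow> (\<lambda>x\<in>topspace X. f x + g x) \<in> D"
    and scale: "\<And>c f. f \<in> D \<Longrightarrow> (\<lambda>x\<in>topspace X. c * f x) \<in> D"
    and lin: "linear_map_on X Y D T"
    and cont: "continuous_map (pointwise_top X D) (pointwise_top Y E) T"
    and y: "y \<in> topspace Y"
  shows "\<exists>w. finite (supp w) \<and> supp w \<subseteq> topspace X \<and> (\<forall>f\<in>D. T f y = pairing w f)"
proof -
  let ?\<phi> = "\<lambda>f. T f y"
  have \<phi>_add: "?\<phi> (\<lambda>x\<in>topspace X. f x + g x) = ?\<phi> f + ?\<phi> g" if "f \<in> D" "g \<in> D" for f g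
    using lin that y by (simp add: linear_map_on_def)
  have \<phi>_scale: "?\<phi> (\<lambda>x\<in>topspace X. c * f x) = c * ?\<phi> f" if "f \<in> D" for c f
    using lin that y by (simp add: linear_map_on_def)
  have Dext: "D \<subseteq> extensional (topspace X)" using D(2) by (auto simp: cont_funs_def)
  then have top: "topspace (pointwise_top X D) = D"
    by (auto simp: pointwise_top_def PiE_def)
  have bdd_in: "(\<lambda>x\<in>topspace X. u x) \<in> D"
    if "continuous_map X euclideanreal u" "bounded (u ` topspace X)" for u
    using restrict_in_bdd_cont_funs[OF that] D(1) by blast
  define z where "z = (\<lambda>x\<in>topspace X. 0 :: real)"
  have zD: "z \<in> D" unfolding z_def by (rule bdd_in) (auto simp: bounded_iff)
  have "z = (\<lambda>x\<in>topspace X. 0 * z x)" by (auto simp: z_def)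
  then have \<phi>z: "?\<phi> z = 0" using \<phi>_scale[OF zD, of 0] by simp
  have "continuous_map (pointwise_top X D) (powertop_real (topspace Y)) T"
    using cont by (simp add: pointwise_top_def continuous_map_in_subtopology)
  then have "continuous_map (pointwise_top X D) euclideanreal ?\<phi>"
    using continuous_map_compose[OF _ continuous_map_product_projection[OF y]] by (simp add: o_def)
  then have "openin (pointwise_top X D) {f \<in> topspace (pointwise_top X D). ?\<phi> f \<in> {-1<..<1}}"
    by (rule openin_continuous_map_preimage) simp
  then obtain W where W: "openin (powertop_real (topspace X)) W"
    "{f \<in> D. ?\<phi> f \<in> {-1<..<1}} = W \<inter> D"
    unfolding top by (auto simp: pointwise_top_def openin_subtopology)
  have "z \<in> {f \<in> D. ?\<phi> f \<in> {-1<..<1}}" using zD \<phi>z by simp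
  then have "z \<in> W" unfolding W(2) by blast
  then obtain U where U: "finite {i \<in> topspace X. U i \<noteq> UNIV}" "z \<in> Pi\<^sub>E (topspace X) U"
    "Pi\<^sub>E (topspace X) U \<subseteq> W"
    using W(1) unfolding openin_product_topology_alt by auto
  define F where "F = {i \<in> topspace X. U i \<noteq> UNIV}"
  have F: "finite F" "F \<subseteq> topspace X" using U(1) by (auto simp: F_def)
  have small: "\<bar>?\<phi> f\<bar> < 1" if f: "f \<in> D" "\<And>x. x \<in> F \<Longrightarrow> f x = 0" for f
  proof -
    have "f x \<in> U x" if "x \<in> topspace X" for x
    proof (cases "x \<in> F")
      case True
      then show ?thesis using f(2) U(2) that by (force simp: z_def PiE_iff)
    next
      case False
      then show ?thesis using that by (simp add: F_def)
    qed
    then have "f \<in> Pi\<^sub>E (topspace X) U" using Dext f(1) by (auto simp: PiE_iff)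
    then have "f \<in> W \<inter> D" using U(3) f(1) by blast
    then have "?\<phi> f \<in> {-1<..<1}" unfolding W(2)[symmetric] by simp
    then show ?thesis by auto
  qed
  have zero: "?\<phi> f = 0" if f: "f \<in> D" "\<And>x. x \<in> F \<Longrightarrow> f x = 0" for f
  proof (rule ccontr)
    assume "?\<phi> f \<noteq> 0"
    moreover have "\<bar>?\<phi> (\<lambda>x\<in>topspace X. (1 / ?\<phi> f) * f x)\<bar> < 1"
      by (rule small[OF scale[OF f(1)]]) (use f(2) F(2) in auto)
    ultimately show False using \<phi>_scale[OF f(1), of "1 / ?\<phi> f"] by simp
  qed
  have "\<exists>u. u \<in> D \<and> (\<forall>x\<in>F. u x = (if x = p then 1 else 0))" for p
  proof -
    obtain u where u: "continuous_map X euclideanreal u" "u ` topspace X \<subseteq> {0..1}"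
      "\<And>x. x \<in> F \<Longrightarrow> u x = (if x = p then 1 else 0)"
      by (rule extension_from_finite[OF X F, of "{}" "{0..1}" "\<lambda>x. if x = p then 1 else 0"])
        (auto simp: is_interval_cc)
    have "bounded (u ` topspace X)" using u(2) bounded_closed_interval bounded_subset by blast
    then have "(\<lambda>x\<in>topspace X. u x) \<in> D" using bdd_in u(1) by blast
    then show ?thesis using u(3) F(2) by (intro exI[of _ "\<lambda>x\<in>topspace X. u x"]) auto
  qed
  then obtain e where eD: "\<And>p. e p \<in> D" and e: "\<And>p x. x \<in> F \<Longrightarrow> e p x = (if x = p then 1 else 0)"
    by metis
  \<comment> \<open>Additivity is given for two summands at a time, with restriction to the carrier;
    finite combinations are rebuilt by induction.\<close>
  have comb: "(\<lambda>x\<in>topspace X. \<Sum>p\<in>G. c p * e p x) \<in> D \<and>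
      ?\<phi> (\<lambda>x\<in>topspace X. \<Sum>p\<in>G. c p * e p x) = (\<Sum>p\<in>G. c p * ?\<phi> (e p))"
    if "finite G" for G c
    using that
  proof (induction G)
    case empty
    show ?case unfolding sum.empty z_def[symmetric] using zD \<phi>z by (rule conjI)
  next
    case (insert p G)
    let ?s = "\<lambda>x\<in>topspace X. \<Sum>p\<in>G. c p * e p x"
    let ?t = "\<lambda>x\<in>topspace X. c p * e p x"
    have eq: "(\<lambda>x\<in>topspace X. \<Sum>p\<in>insert p G. c p * e p x) = (\<lambda>x\<in>topspace X. ?t x + ?s x)"
      using insert.hyps by (intro restrict_ext) simp
    have t: "?t \<in> D" by (rule scale[OF eD])
    have s: "?s \<in> D" "?\<phi> ?s = (\<Sum>p\<in>G. c p * ?\<phi> (e p))" using insert.IH by blast+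
    show ?case unfolding eq
    proof
      show "(\<lambda>x\<in>topspace X. ?t x + ?s x) \<in> D" by (rule add[OF t s(1)])
      show "?\<phi> (\<lambda>x\<in>topspace X. ?t x + ?s x) = (\<Sum>p\<in>insert p G. c p * ?\<phi> (e p))"
        unfolding \<phi>_add[OF t s(1)] \<phi>_scale[OF eD] s(2) using insert.hyps by simp
    qed
  qed
  define w where "w = (\<lambda>x. if x \<in> F then ?\<phi> (e x) else 0)"
  have "supp w \<subseteq> F" by (auto simp: w_def)
  moreover have "?\<phi> f = pairing w f" if f: "f \<in> D" for f
  proof -
    let ?s = "\<lambda>x\<in>topspace X. \<Sum>p\<in>F. f p * e p x"
    have s: "?s \<in> D" "?\<phi> ?s = (\<Sum>p\<in>F. f p * ?\<phi> (e p))" using comb[OF F(1)] by auto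
    \<comment> \<open>Adding \<open>?m\<close> subtracts the interpolant of \<open>f\<close>, and
      the difference vanishes on \<open>F\<close>.\<close>
    let ?m = "\<lambda>x\<in>topspace X. (-1) * ?s x"
    have m: "?m \<in> D" "?\<phi> ?m = - ?\<phi> ?s"
      using scale[OF s(1), of "-1"] \<phi>_scale[OF s(1), of "-1"] unfolding mult_minus1 by blast+
    have "?\<phi> (\<lambda>x\<in>topspace X. f x + ?m x) = 0"
    proof (rule zero[OF add[OF f m(1)]])
      fix x assume x: "x \<in> F"
      have "(\<Sum>p\<in>F. f p * e p x) = (\<Sum>p\<in>F. if p = x then f p else 0)"
        using x by (intro sum.cong) (auto simp: e)
      then have "(\<Sum>p\<in>F. f p * e p x) = f x" using x F(1) by simp
      then show "(\<lambda>x\<in>topspace X. f x + ?m x) x = 0" using x F(2) by auto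
    qed
    then have "?\<phi> f = (\<Sum>p\<in>F. f p * ?\<phi> (e p))" using \<phi>_add[OF f m(1)] m(2) s(2) by simp
    also have "\<dots> = (\<Sum>p\<in>F. w p * f p)" by (intro sum.cong) (auto simp: w_def)
    also have "\<dots> = pairing w f"
      unfolding pairing_def using \<open>supp w \<subseteq> F\<close> F(1) by (intro sum.mono_neutral_right) auto
    finally show ?thesis .
  qed
  ultimately show ?thesis using F finite_subset by (intro exI[of _ w]) auto
qed

theorem theorem4p5:
  fixes X :: "'a topology" and Y :: "'b topology"
    and DX :: "('a \<Rightarrow> real) set" and DY :: "('b \<Rightarrow> real) set"
    and T :: "('a \<Rightarrow> real) \<Rightarrow> ('b \<Rightarrow> real)"
  assumes "metrizable_space X" and "metrizable_space Y"
    and "(DX = cont_funs X \<and> DY = cont_funs Y) \<or> (DX = bdd_cont_funs X \<and> DY = bdd_cont_funs Y)"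
    and "linear_map_on X Y DX T"
    and "continuous_map (pointwise_top X DX) (pointwise_top Y DY) T"
    and "T ` DX = DY"
    and "scattered_space X"
  shows "scattered_space Y"
proof (rule ccontr)
  assume ns: "\<not> scattered_space Y"
  note X = assms(1) and Y = assms(2) and cases = assms(3) and onto = assms(6)
  have bddX: "bdd_cont_funs X \<subseteq> DX" "DX \<subseteq> cont_funs X"
    and bddY: "bdd_cont_funs Y \<subseteq> DY" "DY \<subseteq> cont_funs Y"
    using cases by (auto simp: bdd_cont_funs_def)
  have "(\<lambda>x\<in>topspace X. f x + g x) \<in> DX" if "f \<in> DX" "g \<in> DX" for f g
    using cases that cont_funs_add bdd_cont_funs_add by blast
  moreover have "(\<lambda>x\<in>topspace X. c * f x) \<in> DX" if "f \<in> DX" for c f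
    using cases that cont_funs_scale bdd_cont_funs_scale by blast
  ultimately have "\<exists>w. finite (supp w) \<and> supp w \<subseteq> topspace X \<and> (\<forall>f\<in>DX. T f y = pairing w f)"
    if "y \<in> topspace Y" for y
    using finite_support_representation[OF X bddX _ _ assms(4,5) that] by blast
  then have "\<forall>y. \<exists>w. y \<in> topspace Y \<longrightarrow> finite (supp w) \<and> supp w \<subseteq> topspace X \<and> (\<forall>f\<in>DX. T f y = pairing w f)"
    by blast
  then obtain w where w: "\<forall>y. y \<in> topspace Y \<longrightarrow>
      finite (supp (w y)) \<and> supp (w y) \<subseteq> topspace X \<and> (\<forall>f\<in>DX. T f y = pairing (w y) f)"
    by (metis (no_types))
  have fin: "finite (supp (w y))" and sub: "supp (w y) \<subseteq> topspace X"
    and rep: "f \<in> DX \<Longrightarrow> T f y = pairing (w y) f" if "y \<in> topspace Y" for y f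
    using w that by simp_all
  have T_cont: "continuous_map Y euclideanreal (T f)" if "f \<in> DX" for f
    using onto bddY(2) that by (auto simp: cont_funs_def)

  obtain Q where Q: "countable Q" "Q \<noteq> {}" "Q \<subseteq> topspace Y"
    and crowded: "\<And>U q. openin Y U \<Longrightarrow> q \<in> Q \<Longrightarrow> q \<in> U \<Longrightarrow> \<exists>z\<in>Q. z \<in> U \<and> z \<noteq> q"
    by (rule countable_crowded_if_not_scattered[OF Y ns]) (rule that)
  define D where "D = (\<Union>q\<in>Q. supp (w q))"
  have D: "countable D" "D \<subseteq> topspace X"
    unfolding D_def using Q fin sub by (blast intro: countable_UN countable_finite)+
  define K where "K = X closure_of D"
  have clK: "closedin X K" and DK: "D \<subseteq> K" and KX: "K \<subseteq> topspace X"
    using closure_of_subset[OF D(2)] by (auto simp: K_def closure_of_subset_topspace)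
  have cK: "countable K"
  proof -
    obtain M d where Md: "Metric_space M d" and XM: "X = Metric_space.mtopology M d"
      using X by (auto simp: metrizable_space_def)
    interpret Metric_space M d by (rule Md)
    show ?thesis
      unfolding K_def XM
      by (rule countable_closure_of_if_scattered) (use assms(7) D in \<open>simp_all add: XM\<close>)
  qed
  define Z where "Z = Y closure_of Q"
  have clZ: "closedin Y Z" and QZ: "Q \<subseteq> Z" and ZY: "Z \<subseteq> topspace Y"
    using closure_of_subset[OF Q(3)] by (auto simp: Z_def closure_of_subset_topspace)

  \<comment> \<open>A bump that is 1 at \<open>x0\<close> and 0 on \<open>K\<close> and at the other
    support points isolates the weight \<open>w z x0\<close>. Its image vanishes on
    \<open>Q\<close>, where supports lie in \<open>D\<close>, and so by continuity on the closure
    \<open>Z\<close>.\<close>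
  have suppK: "supp (w z) \<subseteq> K" if z: "z \<in> Z" for z
  proof (rule ccontr)
    assume "\<not> supp (w z) \<subseteq> K"
    then obtain x0 where x0: "w z x0 \<noteq> 0" "x0 \<notin> K" by blast
    have zY: "z \<in> topspace Y" using z ZY by blast
    obtain u where u: "continuous_map X euclideanreal u" "u ` topspace X \<subseteq> {0..1}"
      "\<And>x. x \<in> supp (w z) - K \<Longrightarrow> u x = (if x = x0 then 1 else 0)" "\<And>x. x \<in> K \<Longrightarrow> u x = 0"
      by (rule extension_from_finite[OF X _ _ clK, of "supp (w z) - K" "{0..1}" "\<lambda>x. if x = x0 then 1 else 0"])
        (use fin[OF zY] sub[OF zY] in \<open>auto simp: is_interval_cc\<close>)
    let ?f = "\<lambda>x\<in>topspace X. u x"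
    have "bounded (u ` topspace X)" using u(2) bounded_closed_interval bounded_subset by blast
    then have f: "?f \<in> DX" using restrict_in_bdd_cont_funs u(1) bddX(1) by blast
    have "T ?f q = 0" if "q \<in> Q" for q
    proof -
      have "supp (w q) \<subseteq> K" using that DK by (auto simp: D_def)
      then have "pairing (w q) ?f = 0"
        unfolding pairing_def using u(4) KX by (intro sum.neutral) auto
      then show ?thesis using rep[OF _ f] that Q(3) by auto
    qed
    then have "Q \<subseteq> {y \<in> topspace Y. T ?f y \<in> {0}}" using Q(3) by auto
    moreover have "closedin Y {y \<in> topspace Y. T ?f y \<in> {0}}"
      by (rule closedin_continuous_map_preimage[OF T_cont[OF f]]) simp
    ultimately have "Z \<subseteq> {y \<in> topspace Y. T ?f y \<in> {0}}"
      unfolding Z_def by (rule closure_of_minimal)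
    then have "T ?f z = 0" using z by auto
    moreover have "pairing (w z) ?f = (\<Sum>x\<in>supp (w z). if x = x0 then w z x0 else 0)"
      unfolding pairing_def
    proof (rule sum.cong[OF refl])
      fix x assume x: "x \<in> supp (w z)"
      then have "x \<in> topspace X" using sub[OF zY] by blast
      then show "w z x * ?f x = (if x = x0 then w z x0 else 0)"
        using u(3)[of x] u(4)[of x] x x0 by (cases "x \<in> K") auto
    qed
    then have "pairing (w z) ?f = w z x0" using x0 fin[OF zY] by simp
    ultimately show False using rep[OF zY f] x0 by simp
  qed

  \<comment> \<open>Surjectivity makes the functionals at distinct points linearly independent: some
    \<open>f\<close> is sent to a function that is 1 at \<open>i0\<close> and 0 on the rest of
    \<open>I\<close>. More than \<open>card F\<close> weight vectors supported on \<open>F\<close>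
    are dependent, and \<open>K\<close> has only countably many finite subsets.\<close>
  have cZ: "countable Z"
  proof -
    have "finite {z \<in> Z. supp (w z) = F}" if F: "finite F" for F
    proof (rule ccontr)
      assume "infinite {z \<in> Z. supp (w z) = F}"
      then obtain I where I: "finite I" "card I = Suc (card F)" "I \<subseteq> {z \<in> Z. supp (w z) = F}"
        using infinite_arbitrarily_large by blast
      then obtain c where c: "\<exists>i\<in>I. c i \<noteq> 0" "\<forall>x\<in>F. (\<Sum>i\<in>I. c i * w i x) = 0"
        using nontrivial_linear_relation[OF F I(1), of w] by auto
      obtain i0 where i0: "i0 \<in> I" "c i0 \<noteq> 0" using c(1) by blast
      have IY: "I \<subseteq> topspace Y" using I(3) ZY by blast
      obtain g where g: "continuous_map Y euclideanreal g" "g ` topspace Y \<subseteq> {0..1}"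
        "\<And>y. y \<in> I \<Longrightarrow> g y = (if y = i0 then 1 else 0)"
        by (rule extension_from_finite[OF Y I(1) IY, of "{}" "{0..1}" "\<lambda>y. if y = i0 then 1 else 0"])
          (auto simp: is_interval_cc)
      have "bounded (g ` topspace Y)" using g(2) bounded_closed_interval bounded_subset by blast
      then have "(\<lambda>y\<in>topspace Y. g y) \<in> T ` DX"
        using restrict_in_bdd_cont_funs g(1) bddY(1) onto by blast
      then obtain f where f: "f \<in> DX" "T f = (\<lambda>y\<in>topspace Y. g y)" by auto
      have "pairing (w i) f = (if i = i0 then 1 else 0)" if "i \<in> I" for i
        using rep[OF _ f(1)] f(2) g(3)[OF that] that IY by (metis (no_types, lifting) restrict_apply' subsetD)
      then have "(\<Sum>i\<in>I. c i * pairing (w i) f) = (\<Sum>i\<in>I. if i = i0 then c i else 0)"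
        by (intro sum.cong) auto
      then have c0: "(\<Sum>i\<in>I. c i * pairing (w i) f) = c i0" using i0(1) I(1) by simp
      have "(\<Sum>i\<in>I. c i * pairing (w i) f) = (\<Sum>i\<in>I. \<Sum>x\<in>F. c i * w i x * f x)"
      proof (rule sum.cong[OF refl])
        fix i assume "i \<in> I"
        then have "supp (w i) = F" using I(3) by blast
        then show "c i * pairing (w i) f = (\<Sum>x\<in>F. c i * w i x * f x)"
          by (simp add: pairing_def sum_distrib_left mult.assoc)
      qed
      also have "\<dots> = (\<Sum>x\<in>F. \<Sum>i\<in>I. c i * w i x * f x)" by (rule sum.swap)
      also have "\<dots> = (\<Sum>x\<in>F. (\<Sum>i\<in>I. c i * w i x) * f x)" by (simp only: sum_distrib_right)
      also have "\<dots> = 0" using c(2) by simp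
      finally show False using c0 i0(2) by simp
    qed
    then have "countable {z \<in> Z. supp (w z) = F}" if "F \<in> {F. finite F \<and> F \<subseteq> K}" for F
      using that by (simp add: countable_finite)
    with countable_Collect_finite_subset[OF cK]
    have "countable (\<Union>F\<in>{F. finite F \<and> F \<subseteq> K}. {z \<in> Z. supp (w z) = F})"
      by (rule countable_UN)
    moreover have "Z \<subseteq> (\<Union>F\<in>{F. finite F \<and> F \<subseteq> K}. {z \<in> Z. supp (w z) = F})"
    proof
      fix z assume z: "z \<in> Z"
      then have "finite (supp (w z))" "supp (w z) \<subseteq> K" using fin ZY suppK by auto
      then show "z \<in> (\<Union>F\<in>{F. finite F \<and> F \<subseteq> K}. {z \<in> Z. supp (w z) = F})"
        using z by (intro UN_I[of "supp (w z)"]) auto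
    qed
    ultimately show ?thesis by (rule countable_subset[rotated])
  qed

  define X' where "X' = subtopology X K"
  define Y' where "Y' = subtopology Y Z"
  have topX': "topspace X' = K" and topY': "topspace Y' = Z"
    using KX ZY by (auto simp: X'_def Y'_def)
  have "completely_metrizable_space X'"
    by (rule completely_metrizable_if_countable_scattered)
      (simp_all add: topX' cK, simp_all add: X'_def X metrizable_space_subtopology scattered_space_subtopology assms(7))
  \<comment> \<open>Any complete metric for the topology of \<open>K\<close> will do; it need not
    come from a metric on \<open>X\<close>.\<close>
  then obtain M d where Md: "Metric_space M d" "Metric_space.mcomplete M d" and X'M: "X' = Metric_space.mtopology M d"
    unfolding completely_metrizable_space_def by blast
  have "metrizable_space Y'" by (simp add: Y'_def Y metrizable_space_subtopology)
  then obtain N e where Ne: "Metric_space N e" and Y'N: "Y' = Metric_space.mtopology N e"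
    unfolding metrizable_space_def by blast
  have MK: "M = K" using topX' Metric_space.topspace_mtopology[OF Md(1)] X'M by simp
  have NZ: "N = Z" using topY' Metric_space.topspace_mtopology[OF Ne] Y'N by simp
  interpret finitely_supported_functionals M d N e w
  proof (intro finitely_supported_functionals.intro finitely_supported_functionals_axioms.intro Md Ne)
    show "countable M" "countable N" "N \<noteq> {}" using cK cZ Q(2) QZ by (auto simp: MK NZ)
    show "finite (supp (w y))" "supp (w y) \<subseteq> M" if "y \<in> N" for y
      using fin suppK that ZY by (auto simp: MK NZ)
    show "\<exists>z\<in>N. z \<noteq> q \<and> e q z < r" if q: "q \<in> N" and r: "r > 0" for q r
    proof -
      interpret MY: Metric_space N e by (rule Ne)
      have "openin Y' (MY.mball q r)" by (simp add: Y'N)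
      then obtain U where U: "openin Y U" "MY.mball q r = U \<inter> Z"
        by (auto simp: Y'_def openin_subtopology)
      have "q \<in> U" using U(2) q r by auto
      \<comment> \<open>A neighbourhood of \<open>q\<close> meets \<open>Q\<close>; if it does so in
        \<open>q\<close> itself, crowdedness of \<open>Q\<close> supplies another point.\<close>
      then obtain p where p: "p \<in> Q" "p \<in> U" using q U(1) unfolding NZ Z_def in_closure_of by blast
      obtain z where z: "z \<in> Q" "z \<in> U" "z \<noteq> q"
        using crowded[OF U(1) p] p by (cases "p = q") auto
      then have "z \<in> MY.mball q r" using U(2) QZ by blast
      then show ?thesis using z by auto
    qed
  qed

  \<comment> \<open>Values off \<open>K\<close> are invisible to \<open>w y\<close> for
    \<open>y \<in> Z\<close>, so it does not matter how \<open>f\<close> is extended from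
    \<open>K\<close> to \<open>X\<close>.\<close>
  have restrictK: "pairing (w y) (\<lambda>x\<in>topspace X. u x) = pairing (w y) f"
    if "y \<in> Z" "\<And>x. x \<in> K \<Longrightarrow> u x = f x" for y u f
    using suppK[OF that(1)] that(2) KX by (intro pairing_cong) auto
  have T_restrict: "continuous_map Y.mtopology euclideanreal (\<lambda>y. pairing (w y) f)"
    if u: "(\<lambda>x\<in>topspace X. u x) \<in> DX" "\<And>x. x \<in> K \<Longrightarrow> u x = f x" for u f
  proof -
    have "continuous_map Y' euclideanreal (T (\<lambda>x\<in>topspace X. u x))"
      unfolding Y'_def by (intro continuous_map_from_subtopology T_cont u)
    moreover have "T (\<lambda>x\<in>topspace X. u x) y = pairing (w y) f" if "y \<in> topspace Y'" for y
      using rep[OF _ u(1)] restrictK[OF _ u(2)] that ZY by (auto simp: topY')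
    ultimately show ?thesis unfolding Y'N by (rule continuous_map_eq)
  qed
  have preimage: "\<exists>f. f \<in> DX \<and> continuous_map X.mtopology euclideanreal f \<and> (\<forall>y\<in>N. pairing (w y) f = g y)"
    if u: "(\<lambda>y\<in>topspace Y. u y) \<in> DY" "\<And>y. y \<in> Z \<Longrightarrow> u y = g y" for u g
  proof -
    obtain f where f: "f \<in> DX" "T f = (\<lambda>y\<in>topspace Y. u y)" using u(1) onto by auto
    have "continuous_map X' euclideanreal f"
      unfolding X'_def using f(1) bddX(2) by (intro continuous_map_from_subtopology) (auto simp: cont_funs_def)
    moreover have "pairing (w y) f = g y" if y: "y \<in> N" for y
    proof -
      have "y \<in> topspace Y" using y ZY NZ by blast
      then have "pairing (w y) f = u y" using rep[OF _ f(1), of y] f(2) by simp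
      then show ?thesis using u(2) y NZ by simp
    qed
    ultimately show ?thesis using f(1) unfolding X'M by blast
  qed
  \<comment> \<open>Tietze's theorem carries \<open>f\<close> from \<open>K\<close> to
    \<open>X\<close> and \<open>g\<close> from \<open>Z\<close> to \<open>Y\<close>; a preimage
    under \<open>T\<close> of the extended \<open>g\<close> contradicts the choice of
    \<open>g\<close>.\<close>
  from cases show False
  proof
    assume C: "DX = cont_funs X \<and> DY = cont_funs Y"
    have "continuous_map Y.mtopology euclideanreal (\<lambda>y. pairing (w y) f)"
      if f: "continuous_map X.mtopology euclideanreal f" for f
    proof -
      obtain u where u: "continuous_map X euclideanreal u" "\<And>x. x \<in> K \<Longrightarrow> u x = f x"
        using Tietze_extension_realinterval[OF metrizable_imp_normal_space[OF X] clK is_interval_univ, of f]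
          f[folded X'M, unfolded X'_def] by auto
      show ?thesis by (rule T_restrict[of u]) (use u C restrict_in_cont_funs in auto)
    qed
    then obtain g where g: "continuous_map Y.mtopology euclideanreal g"
      "\<forall>f. continuous_map X.mtopology euclideanreal f \<longrightarrow> (\<exists>y\<in>N. pairing (w y) f \<noteq> g y)"
      using not_onto_continuous by blast
    obtain u where u: "continuous_map Y euclideanreal u" "\<And>y. y \<in> Z \<Longrightarrow> u y = g y"
      using Tietze_extension_realinterval[OF metrizable_imp_normal_space[OF Y] clZ is_interval_univ, of g]
        g(1)[folded Y'N, unfolded Y'_def] by auto
    have "(\<lambda>y\<in>topspace Y. u y) \<in> DY" using C u(1) restrict_in_cont_funs by blast
    then show False using preimage[of u g] u(2) g(2) by blast
  next
    assume C: "DX = bdd_cont_funs X \<and> DY = bdd_cont_funs Y"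
    have ext: "\<exists>u. (\<lambda>x\<in>topspace X. u x) \<in> DX \<and> (\<forall>x\<in>K. u x = f x)"
      if f: "continuous_map X.mtopology euclideanreal f" "bounded (f ` M)" for f
    proof -
      obtain b where b: "\<forall>x\<in>K. \<bar>f x\<bar> \<le> b" using f(2) by (auto simp: bounded_iff MK)
      \<comment> \<open>If \<open>K\<close> is empty, \<open>b\<close> may be negative;
        \<open>\<bar>b\<bar>\<close> ensures a nonempty interval.\<close>
      obtain u where u: "continuous_map X euclideanreal u" "\<And>x. x \<in> K \<Longrightarrow> u x = f x"
        "u ` topspace X \<subseteq> {- \<bar>b\<bar>..\<bar>b\<bar>}"
        using Tietze_extension_closed_real_interval[OF metrizable_imp_normal_space[OF X] clK
            f(1)[folded X'M, unfolded X'_def], of "- \<bar>b\<bar>" "\<bar>b\<bar>"] b by force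
      have "bounded (u ` topspace X)" using u(3) bounded_closed_interval bounded_subset by blast
      then show ?thesis using restrict_in_bdd_cont_funs[OF u(1)] C u(2) by blast
    qed
    have "continuous_map Y.mtopology euclideanreal (\<lambda>y. pairing (w y) f)"
      if f: "continuous_map X.mtopology euclideanreal f" "bounded (f ` M)" for f
      using ext[OF f] T_restrict by blast
    moreover have "bounded ((\<lambda>y. pairing (w y) f) ` N)"
      if f: "continuous_map X.mtopology euclideanreal f" "bounded (f ` M)" for f
    proof -
      obtain u where u: "(\<lambda>x\<in>topspace X. u x) \<in> DX" "\<And>x. x \<in> K \<Longrightarrow> u x = f x"
        using ext[OF f] by blast
      \<comment> \<open>Here it matters that \<open>T\<close> takes bounded values: this is the
        pointwise bound from which uniform boundedness starts.\<close>
      have "T (\<lambda>x\<in>topspace X. u x) \<in> bdd_cont_funs Y" using onto C u(1) by blast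
      then have "bounded (T (\<lambda>x\<in>topspace X. u x) ` topspace Y)" by (simp add: bdd_cont_funs_def)
      moreover have "pairing (w y) f = T (\<lambda>x\<in>topspace X. u x) y" if "y \<in> N" for y
        using rep[OF _ u(1), of y] restrictK[OF _ u(2)] that ZY NZ by auto
      then have "(\<lambda>y. pairing (w y) f) ` N \<subseteq> T (\<lambda>x\<in>topspace X. u x) ` topspace Y"
        using ZY NZ by auto
      ultimately show ?thesis by (rule bounded_subset)
    qed
    ultimately obtain g where g: "continuous_map Y.mtopology euclideanreal g" "bounded (g ` N)"
      "\<forall>f. continuous_map X.mtopology euclideanreal f \<and> bounded (f ` M) \<longrightarrow> (\<exists>y\<in>N. pairing (w y) f \<noteq> g y)"
      using not_onto_bounded_continuous by blast
    obtain b where b: "\<forall>y\<in>Z. \<bar>g y\<bar> \<le> b" using g(2) by (auto simp: bounded_iff NZ)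
    obtain u where u: "continuous_map Y euclideanreal u" "\<And>y. y \<in> Z \<Longrightarrow> u y = g y"
      "u ` topspace Y \<subseteq> {- \<bar>b\<bar>..\<bar>b\<bar>}"
      using Tietze_extension_closed_real_interval[OF metrizable_imp_normal_space[OF Y] clZ
          g(1)[folded Y'N, unfolded Y'_def], of "- \<bar>b\<bar>" "\<bar>b\<bar>"] b by force
    have "bounded (u ` topspace Y)" using u(3) bounded_closed_interval bounded_subset by blast
    then have "(\<lambda>y\<in>topspace Y. u y) \<in> DY" using restrict_in_bdd_cont_funs[OF u(1)] C by blast
    then obtain f where f: "f \<in> DX" "continuous_map X.mtopology euclideanreal f" "\<forall>y\<in>N. pairing (w y) f = g y"
      using preimage[of u g] u(2) by blast
    have "bounded (f ` topspace X)" using f(1) C by (simp add: bdd_cont_funs_def)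
    then have "bounded (f ` M)" using KX MK by (meson bounded_subset image_mono)
    then show False using g(3) f by blast
  qed
qed

end
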